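(* Let $d\ge 3$ and let $T$ be a nonnegative, almost surely finite real random variable with $P(T>0)>0$. Then the $d$-dimensional directionally reinforced random walk with waiting time distribution $\mathcal{L}(T)$ is transient in the sense that every bounded set $B\subset\mathbb{R}^d$ is visited only finitely often almost surely.
   Context: The $d$-dimensional directionally reinforced random walk with waiting time distribution $\mathcal{L}(T)$ is the following motion of a particle in $\mathbb{R}^d$ (or $\mathbb{Z}^d$). The particle starts at the origin with some fixed initial direction among the $2d$ directions $\pm e_1,\dots,\pm e_d$, where $e_1,\dots,e_d$ are the standard unit vectors. It moves with constant velocity along a straight line in its current direction for a random time distributed as $T$, then changes to a different direction, chosen with equal probability among the $2d-1$ directions different from the current one, moves in that direction for a new random time distributed as $T$, and so on. Each choice of direction and each time spent moving in the new direction are completely independent of the past of the motion (in particular the waiting times are i.i.d. with law $\mathcal{L}(T)$). A waiting time may be $0$; then the particle changes direction again at the same location. A bounded set $B$ is visited only finitely often if only finitely many of the straight line segments traversed between successive changes of direction meet $B$. *)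

theory Defs
  imports "HOL-Probability.Probability"
begin

definition directions :: "(real ^ 'n) set" where
  "directions = range (\<lambda>i. axis i 1) \<union> range (\<lambda>i. - axis i 1)"

text \<open>\<open>D n\<close> is the direction of the \<open>n\<close>-th straight line segment and \<open>W n\<close> the time spent on it;
  \<open>history M D W m l\<close> is the \<open>\<sigma>\<close>-algebra generated by \<open>D 0, \<dots>, D m\<close> and \<open>W 0, \<dots>, W (l - 1)\<close>.\<close>

definition history ::
  "'a measure \<Rightarrow> (nat \<Rightarrow> 'a \<Rightarrow> real ^ 'n) \<Rightarrow> (nat \<Rightarrow> 'a \<Rightarrow> real) \<Rightarrow> nat \<Rightarrow> nat \<Rightarrow> 'a set set" where
  "history M D W m l = sigma_sets (space M)
     ((\<Union>k\<in>{..m}. sets (vimage_algebra (space M) (D k) (count_space directions))) \<union>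
      (\<Union>k\<in>{..<l}. sets (vimage_algebra (space M) (W k) borel)))"

text \<open>The measure \<open>\<mu>\<close> is the waiting time distribution and \<open>e0\<close> the initial direction. The assumption
  \<open>direction_step\<close> says that, conditionally on all directions and waiting times up to the
  \<open>n\<close>-th change of direction, the new direction is uniform on the \<open>2d - 1\<close> directions other than
  \<open>D n\<close>. (Summing over \<open>v \<noteq> u\<close> shows that \<open>D (Suc n) = D n\<close> has probability 0.)\<close>

locale directionally_reinforced_walk = prob_space M
  for M :: "'a measure"
    and \<mu> :: "real measure"
    and e0 :: "real ^ 'n"
    and D :: "nat \<Rightarrow> 'a \<Rightarrow> real ^ 'n"
    and W :: "nat \<Rightarrow> 'a \<Rightarrow> real" +
  assumes direction_measurable: "D n \<in> measurable M (count_space directions)"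
    and waiting_time_measurable: "W n \<in> borel_measurable M"
    and initial_direction: "AE \<omega> in M. D 0 \<omega> = e0"
    and direction_step:
      "\<lbrakk>A \<in> history M D W n (Suc n); u \<in> directions; v \<in> directions; v \<noteq> u\<rbrakk> \<Longrightarrow>
        prob (A \<inter> {\<omega> \<in> space M. D n \<omega> = u \<and> D (Suc n) \<omega> = v}) =
        prob (A \<inter> {\<omega> \<in> space M. D n \<omega> = u}) / (2 * real CARD('n) - 1)"
    and waiting_time_distr: "distr M borel (W n) = \<mu>"
    and waiting_time_indep:
      "indep_set (history M D W n n) (sets (vimage_algebra (space M) (W n) borel))"

definition turning_point ::
  "(nat \<Rightarrow> 'a \<Rightarrow> real ^ 'n) \<Rightarrow> (nat \<Rightarrow> 'a \<Rightarrow> real) \<Rightarrow> nat \<Rightarrow> 'a \<Rightarrow> real ^ 'n" where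
  "turning_point D W n \<omega> = (\<Sum>k<n. W k \<omega> *\<^sub>R D k \<omega>)"

definition visited_finitely_often ::
  "(nat \<Rightarrow> 'a \<Rightarrow> real ^ 'n) \<Rightarrow> (nat \<Rightarrow> 'a \<Rightarrow> real) \<Rightarrow> (real ^ 'n) set \<Rightarrow> 'a \<Rightarrow> bool" where
  "visited_finitely_often D W B \<omega> \<longleftrightarrow>
     finite {n. closed_segment (turning_point D W n \<omega>) (turning_point D W (Suc n) \<omega>) \<inter> B \<noteq> {}}"

definition transient_walk ::
  "'a measure \<Rightarrow> (nat \<Rightarrow> 'a \<Rightarrow> real ^ 'n) \<Rightarrow> (nat \<Rightarrow> 'a \<Rightarrow> real) \<Rightarrow> bool" where
  "transient_walk M D W \<longleftrightarrow> (\<forall>B. bounded B \<longrightarrow> (AE \<omega> in M. visited_finitely_often D W B \<omega>))"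

end

theory Submission
  imports Defs "HOL-Combinatorics.Multiset_Permutations"
begin

text \<open>
  By the Borel--Cantelli lemma it is enough that the probability that the \<open>n\<close>-th segment meets a
  given ball of radius \<open>R\<close> is summable in \<open>n\<close>. If the segment runs along the axis \<open>i\<close> and has
  length \<open>\<bar>w n\<bar>\<close>, then the position at its start has every coordinate other than \<open>i\<close> bounded
  by \<open>R\<close> and the coordinate \<open>i\<close> bounded by \<open>R + \<bar>w n\<bar>\<close> (\<open>segment_meets_imp_near_cube\<close>). No moment of the
  waiting time is available, so these events are estimated by a counting argument over the
  directions, for waiting times that are held fixed.
  
  The directions are uniformly distributed over the paths of directions without repetition and are
  independent of the waiting times (\<open>prob_near_cube_le\<close>). Call a step of a path isolated on the axis \<open>a\<close>
  if it runs along \<open>a\<close> while both its neighbours do not. Reversing isolated steps, independently of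
  each other, yields a path of the same kind, so the path may be replaced by a random reflection
  of it. Under this randomisation each coordinate becomes a constant plus a sum of independently
  signed terms, one for each isolated step on that axis, and different coordinates are independent.
  By the Littlewood--Offord inequality (\<open>littlewood_offord\<close>, a consequence of Sperner's theorem), if \<open>k\<close> of these
  terms are at least \<open>\<tau>\<close> in absolute value, such a sum lies in a given interval of length
  proportional to \<open>\<tau>\<close> with probability of order \<open>1 / sqrt k\<close>.
  
  For the two other axes one takes for \<open>\<tau>\<close> a fixed \<open>\<delta> > 0\<close> such that the waiting time is at least \<open>\<delta>\<close> with positive
  probability. There are then of order \<open>n\<close> large isolated steps, up to an exponentially small
  probability (\<open>card_few_isolated_steps\<close>), which gives a factor of order \<open>1 / n\<close>. This alone is not
  summable. The gain comes from the axis \<open>i\<close>: let \<open>u\<close> be of order \<open>n powr (- 1 / 4)\<close> and let \<open>t \<ge> \<delta>\<close> be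
  an upper \<open>u\<close>-quantile of the waiting time (\<open>upper_quantile_abs\<close>). With probability at most \<open>u\<close> the
  \<open>n\<close>-th segment is longer than \<open>t\<close>. Otherwise the coordinate \<open>i\<close> has to lie in an interval of length of
  order \<open>t\<close>, and as there are of order \<open>u * n\<close> isolated steps of length at least \<open>t\<close>, this has probability
  of order \<open>1 / sqrt (u * n)\<close>. Altogether the bound is of order \<open>n powr (- 5 / 4)\<close> (\<open>prob_near_cube_decay\<close>).
\<close>

section \<open>Anticoncentration of signed sums\<close>

text \<open>
  The inequality of Lubell, Yamamoto and Meshalkin: the orderings of \<open>A\<close> that begin with an ordering
  of \<open>S\<close> form disjoint sets for the different members \<open>S\<close> of an antichain.
\<close>

lemma lym_inequality:
  fixes A :: "'c set"
  assumes "finite A" and "F \<subseteq> Pow A"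
    and antichain: "\<And>S T. S \<in> F \<Longrightarrow> T \<in> F \<Longrightarrow> S \<subseteq> T \<Longrightarrow> S = T"
  shows "(\<Sum>S\<in>F. fact (card S) * fact (card A - card S)) \<le> (fact (card A) :: nat)"
proof -
  define P where "P S = (\<lambda>(xs, ys). xs @ ys) ` (permutations_of_set S \<times> permutations_of_set (A - S))"
    for S :: "'c set"
  have fin: "finite F" using assms by (meson finite_Pow_iff finite_subset)
  have subA: "S \<subseteq> A" "finite S" if "S \<in> F" for S
    using that assms by (auto intro: finite_subset)
  have P_prefix: "set (take (card S) zs) = S" if "zs \<in> P S" for S zs
    using that by (auto simp: P_def length_finite_permutations_of_set permutations_of_setD)
  have card_P: "card (P S) = fact (card S) * fact (card A - card S)" if "S \<in> F" for S
  proof -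
    have "inj_on (\<lambda>(xs, ys). xs @ ys) (permutations_of_set S \<times> permutations_of_set (A - S))"
      by (auto intro!: inj_onI simp: length_finite_permutations_of_set)
    then show ?thesis
      using subA[OF that] assms(1)
      by (simp add: P_def card_image card_cartesian_product card_Diff_subset)
  qed
  have disj: "P S \<inter> P T = {}" if "S \<in> F" "T \<in> F" "S \<noteq> T" for S T
  proof (rule ccontr)
    assume "P S \<inter> P T \<noteq> {}"
    then obtain zs where "zs \<in> P S" "zs \<in> P T" by auto
    then have "set (take (card S) zs) = S" "set (take (card T) zs) = T"
      using P_prefix by blast+
    then have "S \<subseteq> T \<or> T \<subseteq> S"
      by (cases "card S \<le> card T") (use set_take_subset_set_take[of "card S" "card T" zs] set_take_subset_set_take[of "card T" "card S" zs] in auto)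
    then show False using antichain that by blast
  qed
  have "(\<Sum>S\<in>F. fact (card S) * fact (card A - card S)) = (\<Sum>S\<in>F. card (P S))"
    using card_P by simp
  also have "\<dots> = card (\<Union>S\<in>F. P S)"
    by (rule card_UN_disjoint[symmetric]) (use fin disj subA in \<open>auto simp: P_def\<close>)
  also have "\<dots> \<le> card (permutations_of_set A)"
    using assms(2) by (intro card_mono finite_permutations_of_set)
      (fastforce simp: P_def permutations_of_set_def)
  finally show ?thesis using assms(1) by simp
qed

lemma sperner:
  fixes A :: "'c set"
  assumes "finite A" and "F \<subseteq> Pow A"
    and "\<And>S T. S \<in> F \<Longrightarrow> T \<in> F \<Longrightarrow> S \<subseteq> T \<Longrightarrow> S = T"
  shows "card F \<le> card A choose (card A div 2)"
proof -
  let ?n = "card A"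
  let ?c = "?n choose (?n div 2)"
  have "fact ?n \<le> ?c * (fact (card S) * fact (?n - card S))" if "S \<in> F" for S
  proof -
    have "card S \<le> ?n" using that assms by (auto intro: card_mono)
    then have "fact (card S) * fact (?n - card S) * (?n choose card S) = fact ?n"
      by (rule binomial_fact_lemma)
    moreover have "?n choose card S \<le> ?c" by (rule binomial_maximum)
    ultimately show ?thesis
      by (metis mult.commute mult_le_mono2)
  qed
  then have "card F * fact ?n \<le> (\<Sum>S\<in>F. ?c * (fact (card S) * fact (?n - card S)))"
    using sum_bounded_below[of F "fact ?n :: nat"] by simp
  also have "\<dots> \<le> ?c * fact ?n"
    using lym_inequality[OF assms] by (simp flip: sum_distrib_left)
  finally show ?thesis by simp
qed

lemma central_binomial_square:
  "(2 * n + 1) * ((2 * n) choose n)\<^sup>2 \<le> (16::nat) ^ n"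
proof (induction n)
  case (Suc n)
  let ?b = "(2 * n) choose n" and ?b' = "(2 * Suc n) choose (Suc n)"
  have ab: "Suc n * ?b' = 2 * (2 * n + 1) * ?b"
  proof -
    have "Suc n * ?b' = 2 * Suc n * (Suc (2 * n) choose n)"
      using Suc_times_binomial_eq[of "Suc (2 * n)" n] by simp
    also have "Suc n * (Suc (2 * n) choose n) = Suc (2 * n) * ?b"
      using binomial_absorb_comp[of "Suc (2 * n)" n] by (simp add: Suc_diff_le)
    then have "2 * Suc n * (Suc (2 * n) choose n) = 2 * (2 * n + 1) * ?b" by simp
    finally show ?thesis .
  qed
  have eq: "(Suc n)\<^sup>2 * ?b'\<^sup>2 = 4 * (2 * n + 1)\<^sup>2 * ?b\<^sup>2"
    using arg_cong[OF ab, of "\<lambda>z. z\<^sup>2"] by (simp only: power_mult_distrib) simp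
  have "(Suc n)\<^sup>2 * ((2 * Suc n + 1) * ?b'\<^sup>2) = (2 * n + 3) * 4 * (2 * n + 1)\<^sup>2 * ?b\<^sup>2"
    using eq by (simp add: algebra_simps)
  also have "\<dots> = 4 * ((2 * n + 3) * (2 * n + 1)) * ((2 * n + 1) * ?b\<^sup>2)"
    by (simp only: power2_eq_square mult_ac)
  also have "\<dots> \<le> 4 * (4 * (Suc n)\<^sup>2) * 16 ^ n"
    by (rule mult_le_mono[OF _ Suc.IH]) (simp add: power2_eq_square algebra_simps)
  finally have "(Suc n)\<^sup>2 * ((2 * Suc n + 1) * ?b'\<^sup>2) \<le> (Suc n)\<^sup>2 * 16 ^ Suc n"
    by simp
  then show ?case by (simp only: mult_le_cancel1 zero_less_power zero_less_Suc simp_thms)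
qed simp

lemma central_binomial_bound:
  "real (n choose (n div 2)) \<le> 2 ^ n / sqrt (real n + 1)"
proof -
  have even_case: "real ((2 * k) choose k) \<le> 2 ^ (2 * k) / sqrt (real (2 * k) + 1)" for k
  proof -
    have "real ((2 * k + 1) * ((2 * k) choose k)\<^sup>2) \<le> real (16 ^ k)"
      using central_binomial_square by (simp only: of_nat_le_iff)
    moreover have "(16::real) ^ k = (2 ^ (2 * k))\<^sup>2"
      by (simp add: power_mult power2_eq_square flip: power_mult_distrib)
    ultimately have "(real (2 * k) + 1) * (real ((2 * k) choose k))\<^sup>2 \<le> (2 ^ (2 * k))\<^sup>2"
      by (simp add: algebra_simps)
    then have "(sqrt (real (2 * k) + 1) * real ((2 * k) choose k))\<^sup>2 \<le> (2 ^ (2 * k))\<^sup>2"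
      by (simp add: power_mult_distrib)
    then have "sqrt (real (2 * k) + 1) * real ((2 * k) choose k) \<le> 2 ^ (2 * k)"
      by (rule power2_le_imp_le) simp
    then show ?thesis by (simp add: field_simps)
  qed
  show ?thesis
  proof (cases "even n")
    case True
    then show ?thesis using even_case[of "n div 2"] by simp
  next
    case False
    then obtain k where k: "n = 2 * k + 1" by (elim oddE)
    have "2 * (n choose (n div 2)) = (2 * Suc k) choose Suc k"
      using k binomial_symmetric[of k "2 * k + 1"] by simp
    then have "2 * real (n choose (n div 2)) \<le> 2 ^ (2 * Suc k) / sqrt (real (2 * Suc k) + 1)"
      using even_case[of "Suc k"] by (metis of_nat_mult of_nat_numeral)
    also have "\<dots> \<le> 2 ^ (2 * Suc k) / sqrt (real n + 1)"
      using k by (intro divide_left_mono) auto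
    finally show ?thesis using k by simp
  qed
qed

text \<open>
  The Littlewood--Offord inequality in the form of Erdos. A subset \<open>S\<close> of \<open>A\<close> stands for the choice of
  signs in which the terms with index in \<open>S\<close> are reversed, so that the real number \<open>t\<close> is the sum
  before reversal (plus an arbitrary constant).
\<close>

lemma littlewood_offord:
  fixes x :: "'c \<Rightarrow> real"
  assumes "finite A" and \<tau>: "0 < \<tau>" "\<And>j. j \<in> A \<Longrightarrow> \<tau> \<le> \<bar>x j\<bar>" and "0 \<le> K"
  shows "real (card {S \<in> Pow A. \<bar>t - 2 * (\<Sum>j\<in>S. x j)\<bar> \<le> K})
           \<le> (K / \<tau> + 1) / sqrt (real (card A) + 1) * 2 ^ card A"
proof -
  define y where "y S = (\<Sum>j\<in>S. x j)" for S
  define Q where "Q b = {S \<in> Pow A. b \<le> y S \<and> y S < b + \<tau>}" for b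
  \<comment> \<open>Exchanging the roles of chosen and not chosen at the negative terms makes all terms
      positive. A half-open interval of length \<open>\<tau>\<close> then contains the sums of an antichain only.\<close>
  define Neg where "Neg = {j \<in> A. x j < 0}"
  have card_Q: "card (Q b) \<le> card A choose (card A div 2)" for b
  proof -
    let ?g = "\<lambda>S. sym_diff S Neg"
    have inj: "inj_on ?g (Q b)"
      by (rule inj_on_inverseI[where g = ?g]) auto
    have y_eq: "y S = (\<Sum>j\<in>?g S. \<bar>x j\<bar>) + (\<Sum>j\<in>Neg. x j)" if "S \<subseteq> A" for S
    proof -
      have [simp]: "finite S" "finite Neg"
        using that assms(1) by (auto simp: Neg_def intro: finite_subset)
      have "y S = y (S - Neg) + y (S \<inter> Neg)" "y Neg = y (Neg - S) + y (S \<inter> Neg)"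
        unfolding y_def
        by (subst sum.union_disjoint[symmetric]; auto intro!: sum.cong)+
      moreover have "(\<Sum>j\<in>?g S. \<bar>x j\<bar>) = (\<Sum>j\<in>S - Neg. \<bar>x j\<bar>) + (\<Sum>j\<in>Neg - S. \<bar>x j\<bar>)"
        by (rule sum.union_disjoint) auto
      moreover have "(\<Sum>j\<in>S - Neg. \<bar>x j\<bar>) = y (S - Neg)"
        unfolding y_def using that by (intro sum.cong) (auto simp: Neg_def)
      moreover have "(\<Sum>j\<in>Neg - S. \<bar>x j\<bar>) = - y (Neg - S)"
        unfolding y_def sum_negf[symmetric] by (intro sum.cong) (auto simp: Neg_def)
      ultimately show ?thesis by (simp add: y_def)
    qed
    have "card (?g ` Q b) \<le> card A choose (card A div 2)"
    proof (rule sperner[OF assms(1)])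
      show "?g ` Q b \<subseteq> Pow A" by (auto simp: Q_def Neg_def)
    next
      fix U V assume "U \<in> ?g ` Q b" "V \<in> ?g ` Q b" and UV: "U \<subseteq> V"
      then obtain S S' where S: "S \<in> Q b" "U = ?g S" and S': "S' \<in> Q b" "V = ?g S'" by auto
      have V: "V \<subseteq> A" using S' by (auto simp: Q_def Neg_def)
      show "U = V"
      proof (rule ccontr)
        assume "U \<noteq> V"
        then obtain j where j: "j \<in> V - U" using UV by auto
        have "\<tau> \<le> \<bar>x j\<bar>" using j V \<tau> by auto
        also have "\<dots> \<le> (\<Sum>j\<in>V - U. \<bar>x j\<bar>)"
          using j V assms(1) by (intro member_le_sum) (auto intro: finite_subset)
        also have "\<dots> = (\<Sum>j\<in>V. \<bar>x j\<bar>) - (\<Sum>j\<in>U. \<bar>x j\<bar>)"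
          using UV V assms(1) by (intro sum_diff) (auto intro: finite_subset)
        also have "\<dots> = y S' - y S"
          using y_eq[of S] y_eq[of S'] S S' by (auto simp: Q_def)
        also have "\<dots> < \<tau>" using S S' by (auto simp: Q_def)
        finally show False by simp
      qed
    qed
    then show ?thesis by (simp add: card_image[OF inj])
  qed
  \<comment> \<open>The sum over \<open>S\<close> has to lie in an interval of length \<open>K\<close> with left end \<open>b\<close>, which is covered
      by \<open>m + 1\<close> half-open intervals of length \<open>\<tau>\<close>.\<close>
  define m where "m = nat \<lfloor>K / \<tau>\<rfloor>"
  define b where "b = (t - K) / 2"
  have m_le: "real m \<le> K / \<tau>" and m_gt: "K / \<tau> < real m + 1"
    using \<open>0 \<le> K\<close> \<tau>(1) by (auto simp: m_def)
  have "{S \<in> Pow A. \<bar>t - 2 * (\<Sum>j\<in>S. x j)\<bar> \<le> K} \<subseteq> (\<Union>l\<in>{..m}. Q (b + real l * \<tau>))"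
  proof
    fix S assume "S \<in> {S \<in> Pow A. \<bar>t - 2 * (\<Sum>j\<in>S. x j)\<bar> \<le> K}"
    then have S: "S \<subseteq> A" "b \<le> y S" "y S \<le> b + K"
      by (auto simp: b_def y_def field_simps)
    define l where "l = nat \<lfloor>(y S - b) / \<tau>\<rfloor>"
    have l: "real l \<le> (y S - b) / \<tau>" "(y S - b) / \<tau> < real l + 1"
      using S \<tau>(1) by (auto simp: l_def)
    have "(y S - b) / \<tau> \<le> K / \<tau>" using S \<tau>(1) by (intro divide_right_mono) auto
    then have "l \<le> m" using l m_gt by linarith
    moreover have "S \<in> Q (b + real l * \<tau>)"
      using l S \<tau>(1) by (auto simp: Q_def field_simps)
    ultimately show "S \<in> (\<Union>l\<in>{..m}. Q (b + real l * \<tau>))" by auto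
  qed
  then have "card {S \<in> Pow A. \<bar>t - 2 * (\<Sum>j\<in>S. x j)\<bar> \<le> K} \<le> card (\<Union>l\<in>{..m}. Q (b + real l * \<tau>))"
    using assms(1) by (intro card_mono) (auto simp: Q_def)
  also have "\<dots> \<le> (\<Sum>l\<le>m. card (Q (b + real l * \<tau>)))" by (rule card_UN_le) simp
  also have "\<dots> \<le> (\<Sum>l\<le>m. card A choose (card A div 2))" by (intro sum_mono card_Q)
  finally have "real (card {S \<in> Pow A. \<bar>t - 2 * (\<Sum>j\<in>S. x j)\<bar> \<le> K})
      \<le> real ((m + 1) * (card A choose (card A div 2)))" by (simp only: of_nat_le_iff) simp
  also have "\<dots> = (real m + 1) * real (card A choose (card A div 2))" by (simp add: algebra_simps)
  also have "\<dots> \<le> (K / \<tau> + 1) * (2 ^ card A / sqrt (real (card A) + 1))"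
    using m_le \<open>0 \<le> K\<close> \<tau>(1) by (intro mult_mono central_binomial_bound) auto
  also have "\<dots> = (K / \<tau> + 1) / sqrt (real (card A) + 1) * 2 ^ card A" by simp
  finally show ?thesis .
qed

text \<open>
  Conditions on the parts of a uniformly random subset inside and outside \<open>A\<close> are independent.
\<close>

lemma card_Pow_disjoint_conditions:
  assumes "finite U" "A \<subseteq> U"
    and "real (card {S \<in> Pow A. P S}) \<le> \<alpha> * 2 ^ card A"
    and "real (card {S \<in> Pow (U - A). Q S}) \<le> \<beta> * 2 ^ card (U - A)"
  shows "real (card {S \<in> Pow U. P (S \<inter> A) \<and> Q (S - A)}) \<le> \<alpha> * \<beta> * 2 ^ card U"
proof -
  have fin: "finite A" "finite (U - A)" using assms by (auto intro: finite_subset)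
  have "bij_betw (\<lambda>S. (S \<inter> A, S - A)) {S \<in> Pow U. P (S \<inter> A) \<and> Q (S - A)}
          ({S \<in> Pow A. P S} \<times> {S \<in> Pow (U - A). Q S})"
    using assms(2)
    by (intro bij_betwI[where g = "\<lambda>(S, S'). S \<union> S'"])
       (auto simp: Int_Un_distrib2 Un_Diff Int_absorb2 Diff_triv
             intro: back_subst[of P] back_subst[of Q])
  then have "real (card {S \<in> Pow U. P (S \<inter> A) \<and> Q (S - A)})
      = real (card {S \<in> Pow A. P S}) * real (card {S \<in> Pow (U - A). Q S})"
    by (simp add: bij_betw_same_card card_cartesian_product)
  also have "\<dots> \<le> (\<alpha> * 2 ^ card A) * (\<beta> * 2 ^ card (U - A))"
    by (intro mult_mono assms order_trans[OF _ assms(3)]) auto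
  also have "\<dots> = \<alpha> * \<beta> * 2 ^ (card A + card (U - A))" by (simp add: power_add)
  also have "card A + card (U - A) = card U"
    using assms fin by (simp add: card_Diff_subset card_mono)
  finally show ?thesis .
qed

section \<open>Paths of directions and their reflections\<close>

lemma directions_iff:
  "v \<in> directions \<longleftrightarrow> (\<exists>i. v = axis i 1 \<or> v = - axis i (1::real))"
  by (auto simp: directions_def)

lemma finite_directions [simp]: "finite (directions :: (real ^ 'n) set)"
  by (simp add: directions_def)

lemma axis_neq_uminus_axis: "axis i (1::real) \<noteq> - axis j 1"
proof
  assume "axis i (1::real) = - axis j 1"
  then have "axis i (1::real) $ i = (- axis j 1) $ i" by simp
  then show False by (simp add: axis_def split: if_splits)
qed

lemma card_directions: "card (directions :: (real ^ 'n) set) = 2 * CARD('n)"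
proof -
  have "inj (\<lambda>i::'n. axis i (1::real))" "inj (\<lambda>i::'n. - axis i (1::real))"
    by (auto simp: inj_on_def axis_eq_axis)
  moreover have "range (\<lambda>i::'n. axis i (1::real)) \<inter> range (\<lambda>i. - axis i 1) = {}"
    using axis_neq_uminus_axis by blast
  ultimately show ?thesis
    by (simp add: directions_def card_Un_disjoint card_image)
qed

lemma uminus_directions [simp]: "- v \<in> directions \<longleftrightarrow> v \<in> directions"
  by (metis directions_iff minus_minus)

lemma direction_nth_unique: "v \<in> directions \<Longrightarrow> v $ a \<noteq> 0 \<Longrightarrow> v $ b \<noteq> 0 \<Longrightarrow> a = b"
  by (auto simp: directions_iff axis_def split: if_splits)

lemma direction_nth_abs: "v \<in> directions \<Longrightarrow> v $ a \<noteq> 0 \<Longrightarrow> \<bar>v $ a\<bar> = 1"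
  by (auto simp: directions_iff axis_def split: if_splits)

lemma direction_nonzero_nth: "v \<in> directions \<Longrightarrow> \<exists>a. v $ a \<noteq> 0"
  by (auto simp: directions_iff axis_def)

text \<open>
  The possible values of the first \<open>n + 1\<close> directions. The value after time \<open>n\<close> is set to 0 so that there
  are only finitely many such functions.
\<close>

definition direction_paths :: "real ^ 'n \<Rightarrow> nat \<Rightarrow> (nat \<Rightarrow> real ^ 'n) set" where
  "direction_paths e0 n = {d. d 0 = e0 \<and> (\<forall>k\<le>n. d k \<in> directions) \<and>
     (\<forall>k<n. d (Suc k) \<noteq> d k) \<and> (\<forall>k>n. d k = 0)}"

lemma direction_pathsD:
  assumes "d \<in> direction_paths e0 n"
  shows "d 0 = e0" "k \<le> n \<Longrightarrow> d k \<in> directions" "k < n \<Longrightarrow> d (Suc k) \<noteq> d k" "n < k \<Longrightarrow> d k = 0"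
  using assms by (auto simp: direction_paths_def)

lemma direction_paths_0: "e0 \<in> directions \<Longrightarrow> direction_paths e0 0 = {(\<lambda>_. 0)(0 := e0)}"
  by (auto simp: direction_paths_def fun_eq_iff)

lemma bij_betw_direction_paths_Suc:
  "bij_betw (\<lambda>(d, v). d(Suc n := v)) (SIGMA d:direction_paths e0 n. directions - {d n})
     (direction_paths e0 (Suc n))"
proof (rule bij_betwI[where g = "\<lambda>d. (d(Suc n := 0), d (Suc n))"])
  show "(\<lambda>(d, v). d(Suc n := v)) \<in>
      (SIGMA d:direction_paths e0 n. directions - {d n}) \<rightarrow> direction_paths e0 (Suc n)"
    by (auto simp: direction_paths_def less_Suc_eq le_Suc_eq)
  show "(\<lambda>d. (d(Suc n := 0), d (Suc n))) \<in>
      direction_paths e0 (Suc n) \<rightarrow> (SIGMA d:direction_paths e0 n. directions - {d n})"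
    by (auto simp: direction_paths_def)
qed (auto simp: direction_paths_def fun_eq_iff)

lemma finite_direction_paths:
  fixes e0 :: "real ^ 'n"
  assumes "e0 \<in> directions"
  shows "finite (direction_paths e0 n)"
proof (induction n)
  case 0
  then show ?case using assms by (simp add: direction_paths_0)
next
  case (Suc n)
  then have "finite (SIGMA d:direction_paths e0 n. directions - {d n})" by auto
  then show ?case using bij_betw_finite[OF bij_betw_direction_paths_Suc] by blast
qed

lemma sum_direction_paths_Suc:
  fixes e0 :: "real ^ 'n"
  assumes "e0 \<in> directions"
  shows "sum F (direction_paths e0 (Suc n))
    = (\<Sum>d\<in>direction_paths e0 n. \<Sum>v\<in>directions - {d n}. F (d(Suc n := v)))"
proof -
  have "sum F (direction_paths e0 (Suc n))
      = (\<Sum>(d, v)\<in>(SIGMA d:direction_paths e0 n. directions - {d n}). F (d(Suc n := v)))"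
    by (subst sum.reindex_bij_betw[OF bij_betw_direction_paths_Suc, symmetric])
       (simp add: case_prod_unfold)
  also have "\<dots> = (\<Sum>d\<in>direction_paths e0 n. \<Sum>v\<in>directions - {d n}. F (d(Suc n := v)))"
    by (rule sum.Sigma[symmetric]) (auto simp: finite_direction_paths[OF assms])
  finally show ?thesis .
qed

lemma card_other_directions:
  fixes u :: "real ^ 'n"
  assumes "u \<in> directions"
  shows "real (card (directions - {u})) = 2 * real CARD('n) - 1"
proof -
  have "0 < CARD('n)" by simp
  then show ?thesis using assms by (simp add: card_directions of_nat_diff Suc_le_eq)
qed

lemma card_direction_paths:
  fixes e0 :: "real ^ 'n"
  assumes "e0 \<in> directions"
  shows "real (card (direction_paths e0 n)) = (2 * real CARD('n) - 1) ^ n"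
proof (induction n)
  case 0
  then show ?case using assms by (simp add: direction_paths_0)
next
  case (Suc n)
  have "real (card (direction_paths e0 (Suc n))) = (\<Sum>d\<in>direction_paths e0 (Suc n). 1)" by simp
  also have "\<dots> = (\<Sum>d\<in>direction_paths e0 n. real (card (directions - {d n})))"
    unfolding sum_direction_paths_Suc[OF assms] by simp
  also have "\<dots> = (\<Sum>d\<in>direction_paths e0 n. 2 * real CARD('n) - 1)"
    by (intro sum.cong refl card_other_directions direction_pathsD) auto
  finally show ?case using Suc.IH by (simp add: mult.commute)
qed

text \<open>
  The first \<open>3 * K\<close> steps after the initial one are divided into blocks of three. A block is counted
  by its number \<open>k < K\<close>; it belongs to \<open>isolated_steps w \<tau> K a d\<close> if its middle step runs along the axis
  \<open>a\<close>, its two other steps do not, and the middle step takes a time of absolute value at least \<open>\<tau> a\<close>.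
  Only middle steps of blocks are considered, so that no two of them are neighbours. The threshold
  may depend on the axis.
\<close>

definition isolated_steps ::
  "(nat \<Rightarrow> real) \<Rightarrow> ('n \<Rightarrow> real) \<Rightarrow> nat \<Rightarrow> 'n \<Rightarrow> (nat \<Rightarrow> real ^ 'n) \<Rightarrow> nat set" where
  "isolated_steps w \<tau> K a d = {k\<in>{..<K}. d (3 * k + 1) $ a = 0 \<and> d (3 * k + 2) $ a \<noteq> 0 \<and>
     d (3 * k + 3) $ a = 0 \<and> \<tau> a \<le> \<bar>w (3 * k + 2)\<bar>}"

text \<open>
  The path \<open>d\<close> with the middle step reversed in every block in \<open>S\<close> that is isolated on some axis.
\<close>

definition flip_steps ::
  "(nat \<Rightarrow> real) \<Rightarrow> ('n \<Rightarrow> real) \<Rightarrow> nat \<Rightarrow> nat set \<Rightarrow> (nat \<Rightarrow> real ^ 'n) \<Rightarrow> nat \<Rightarrow> real ^ 'n" where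
  "flip_steps w \<tau> K S d =
     (\<lambda>j. if \<exists>k\<in>S. j = 3 * k + 2 \<and> (\<exists>a. k \<in> isolated_steps w \<tau> K a d) then - d j else d j)"

text \<open>
  The \<open>n\<close>-th turning point for given waiting times \<open>w\<close> and directions \<open>d\<close>.
\<close>

definition position :: "(nat \<Rightarrow> real) \<Rightarrow> (nat \<Rightarrow> real ^ 'n) \<Rightarrow> nat \<Rightarrow> real ^ 'n" where
  "position w d n = (\<Sum>k<n. w k *\<^sub>R d k)"

text \<open>
  A condition, measurable and separate for each coordinate, that is necessary for the \<open>n\<close>-th segment
  to meet the ball of radius \<open>R\<close> around the origin. On the axis of the segment the bound is
  \<open>R + \<bar>w n\<bar>\<close>, on all others it is \<open>R\<close>.
\<close>

definition near_cube :: "(nat \<Rightarrow> real) \<Rightarrow> real \<Rightarrow> nat \<Rightarrow> (nat \<Rightarrow> real ^ 'n) \<Rightarrow> bool" where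
  "near_cube w R n d \<longleftrightarrow> (\<forall>a. \<bar>position w d n $ a\<bar> \<le> R + \<bar>w n\<bar> * \<bar>d n $ a\<bar>)"

lemma isolated_steps_subset: "isolated_steps w \<tau> K a d \<subseteq> {..<K}"
  by (auto simp: isolated_steps_def)

lemma flip_steps_other: "j mod 3 \<noteq> 2 \<Longrightarrow> flip_steps w \<tau> K S d j = d j"
proof -
  assume "j mod 3 \<noteq> 2"
  then have "j \<noteq> 3 * k + 2" for k by presburger
  then show ?thesis by (simp add: flip_steps_def)
qed

lemma flip_steps_middle:
  "flip_steps w \<tau> K S d (3 * k + 2)
    = (if k \<in> S \<and> (\<exists>a. k \<in> isolated_steps w \<tau> K a d) then - d (3 * k + 2) else d (3 * k + 2))"
  by (auto simp: flip_steps_def)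

lemma flip_steps_neighbours:
  "flip_steps w \<tau> K S d (3 * k + 1) = d (3 * k + 1)"
  "flip_steps w \<tau> K S d (3 * k + 3) = d (3 * k + 3)"
  by (rule flip_steps_other; presburger)+

lemma isolated_steps_flip [simp]:
  "isolated_steps w \<tau> K a (flip_steps w \<tau> K S d) = isolated_steps w \<tau> K a d"
proof -
  have "flip_steps w \<tau> K S d (3 * k + 2) $ a \<noteq> 0 \<longleftrightarrow> d (3 * k + 2) $ a \<noteq> 0" for k
    unfolding flip_steps_middle by simp
  then show ?thesis
    unfolding isolated_steps_def flip_steps_neighbours by simp
qed

lemma flip_steps_flip [simp]: "flip_steps w \<tau> K S (flip_steps w \<tau> K S d) = d"
  unfolding flip_steps_def[of w \<tau> K S "flip_steps w \<tau> K S d"] isolated_steps_flip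
  by (auto simp: flip_steps_def fun_eq_iff)

text \<open>
  A reversed step still differs from its neighbours because they run along other axes.
\<close>

lemma flip_steps_in_direction_paths:
  assumes d: "d \<in> direction_paths e0 n" and "3 * K \<le> n"
  shows "flip_steps w \<tau> K S d \<in> direction_paths e0 n"
proof -
  let ?f = "flip_steps w \<tau> K S d"
  have middle: "?f (3 * k + 2) = d (3 * k + 2) \<or>
      (\<exists>a. d (3 * k + 1) $ a = 0 \<and> d (3 * k + 3) $ a = 0 \<and> ?f (3 * k + 2) $ a \<noteq> 0)" for k
    unfolding flip_steps_middle by (auto simp: isolated_steps_def)
  have "?f (Suc j) \<noteq> ?f j" if "j < n" for j
  proof -
    have neq: "d (Suc j) \<noteq> d j" using direction_pathsD(3)[OF d that] .
    consider k where "j = 3 * k + 1" | k where "j = 3 * k + 2" | "j mod 3 \<noteq> 2" "Suc j mod 3 \<noteq> 2"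
      by (metis (no_types) mult_div_mod_eq mod_Suc Suc_1 add_2_eq_Suc' One_nat_def add.commute
          mod_less_divisor zero_less_numeral numeral_3_eq_3 old.nat.inject)
    then show ?thesis
    proof cases
      case (1 k)
      then have "d (3 * k + 2) \<noteq> d (3 * k + 1)" using neq by simp
      then have "?f (3 * k + 2) \<noteq> ?f (3 * k + 1)"
        using middle[of k] unfolding flip_steps_neighbours by metis
      then show ?thesis using 1 by simp
    next
      case (2 k)
      then have "d (3 * k + 3) \<noteq> d (3 * k + 2)" using neq by (simp add: eval_nat_numeral)
      then have "?f (3 * k + 3) \<noteq> ?f (3 * k + 2)"
        using middle[of k] unfolding flip_steps_neighbours by metis
      then show ?thesis using 2 by (simp add: eval_nat_numeral)
    next
      case 3
      then show ?thesis using neq by (simp add: flip_steps_other)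
    qed
  qed
  moreover have "?f 0 = e0" using direction_pathsD(1)[OF d] by (simp add: flip_steps_other)
  moreover have "?f k \<in> directions" if "k \<le> n" for k
    using direction_pathsD(2)[OF d that] by (simp add: flip_steps_def)
  moreover have "?f k = 0" if "n < k" for k
    using direction_pathsD(4)[OF d that] by (simp add: flip_steps_def)
  ultimately show ?thesis by (simp add: direction_paths_def)
qed

lemma isolated_steps_disjoint:
  assumes "d \<in> direction_paths e0 n" "3 * K \<le> n" "a \<noteq> b"
  shows "isolated_steps w \<tau> K a d \<inter> isolated_steps w \<tau> K b d = {}"
proof -
  have "a = b" if "k < K" "d (3 * k + 2) $ a \<noteq> 0" "d (3 * k + 2) $ b \<noteq> 0" for k
    by (rule direction_nth_unique[OF direction_pathsD(2)[OF assms(1), of "3 * k + 2"] that(2,3)])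
       (use that assms(2) in linarith)
  then show ?thesis using assms(3) by (auto simp: isolated_steps_def)
qed

text \<open>
  The reversals on the axis \<open>a\<close> change no other coordinate.
\<close>

lemma position_flip:
  assumes d: "d \<in> direction_paths e0 n" and K: "3 * K \<le> n"
  shows "position w (flip_steps w \<tau> K S d) n $ a = position w d n $ a
    - 2 * (\<Sum>k\<in>S \<inter> isolated_steps w \<tau> K a d. w (3 * k + 2) * d (3 * k + 2) $ a)"
proof -
  let ?I = "(\<lambda>k. 3 * k + 2) ` (S \<inter> isolated_steps w \<tau> K a d)"
  have eq: "flip_steps w \<tau> K S d j $ a = d j $ a - (if j \<in> ?I then 2 * d j $ a else 0)" if "j < n" for j
  proof (cases "\<exists>k\<in>S. j = 3 * k + 2 \<and> (\<exists>b. k \<in> isolated_steps w \<tau> K b d)")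
    case True
    then obtain k b where k: "k \<in> S" "j = 3 * k + 2" "k \<in> isolated_steps w \<tau> K b d" by auto
    then have "a = b" if "d j $ a \<noteq> 0"
      using that direction_nth_unique[OF direction_pathsD(2)[OF d, of j], of a b] \<open>j < n\<close>
      by (auto simp: isolated_steps_def)
    then show ?thesis using k True by (auto simp: flip_steps_def)
  next
    case False
    then show ?thesis by (auto simp: flip_steps_def)
  qed
  have "?I \<subseteq> {..<n}" using K by (auto simp: isolated_steps_def)
  then have sub: "{..<n} \<inter> ?I = ?I" by auto
  have "position w (flip_steps w \<tau> K S d) n $ a
      = (\<Sum>j<n. w j * d j $ a - (if j \<in> ?I then 2 * (w j * d j $ a) else 0))"
    unfolding position_def by (auto simp: eq algebra_simps intro!: sum.cong)
  also have "\<dots> = position w d n $ a - (\<Sum>j\<in>?I. 2 * (w j * d j $ a))"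
    unfolding sum_subtractf sum.inter_restrict[OF finite_lessThan, symmetric] sub
    by (simp add: position_def)
  also have "(\<Sum>j\<in>?I. 2 * (w j * d j $ a))
      = 2 * (\<Sum>k\<in>S \<inter> isolated_steps w \<tau> K a d. w (3 * k + 2) * d (3 * k + 2) $ a)"
    by (subst sum.reindex) (auto simp: inj_on_def sum_distrib_left)
  finally show ?thesis .
qed

lemma flip_steps_last:
  assumes "3 * K \<le> n"
  shows "flip_steps w \<tau> K S d n = d n"
  using assms by (auto simp: flip_steps_def isolated_steps_def)

lemma card_flips_one_axis:
  assumes d: "d \<in> direction_paths e0 n" and K: "3 * K \<le> n" and "0 < \<tau> a" "0 \<le> B"
  shows "real (card {S \<in> Pow (isolated_steps w \<tau> K a d).
      \<bar>t - 2 * (\<Sum>k\<in>S. w (3 * k + 2) * d (3 * k + 2) $ a)\<bar> \<le> B})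
    \<le> ((B / \<tau> a + 1) / sqrt (real (card (isolated_steps w \<tau> K a d)) + 1))
        * 2 ^ card (isolated_steps w \<tau> K a d)"
proof -
  have large: "\<tau> a \<le> \<bar>w (3 * k + 2) * d (3 * k + 2) $ a\<bar>" if "k \<in> isolated_steps w \<tau> K a d" for k
  proof -
    have "d (3 * k + 2) \<in> directions" "d (3 * k + 2) $ a \<noteq> 0"
      using that K direction_pathsD(2)[OF d, of "3 * k + 2"] by (auto simp: isolated_steps_def)
    then have "\<bar>d (3 * k + 2) $ a\<bar> = 1" by (rule direction_nth_abs)
    then show ?thesis using that by (simp add: abs_mult isolated_steps_def)
  qed
  show ?thesis
    by (rule littlewood_offord[OF finite_subset[OF isolated_steps_subset finite_lessThan]
          \<open>0 < \<tau> a\<close> large \<open>0 \<le> B\<close>])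
qed

text \<open>
  Under random reversals the coordinates on the three axes \<open>i\<close>, \<open>b\<close> and \<open>c\<close> are independent, so the bounds
  for the single axes multiply. A last segment longer than \<open>t\<close> is treated as a success on its own axis.
\<close>

lemma card_flips_near_cube:
  fixes d :: "nat \<Rightarrow> real ^ 'n" and i b c :: 'n and w :: "nat \<Rightarrow> real"
  assumes d: "d \<in> direction_paths e0 n" and K: "3 * K \<le> n"
    and \<delta>: "0 < \<delta>" "\<delta> \<le> t" and \<tau>: "\<tau> = (\<lambda>a. if a = i then t else \<delta>)" and "0 \<le> R"
    and ibc: "i \<noteq> b" "i \<noteq> c" "b \<noteq> c" and dni: "d n $ i \<noteq> 0"
  defines "J \<equiv> \<lambda>a. real (card (isolated_steps w \<tau> K a d)) + 1" and "C \<equiv> R / \<delta> + 2"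
  shows "real (card {S \<in> Pow {..<K}. near_cube w R n (flip_steps w \<tau> K S d)})
    \<le> C / sqrt (J b) * (C / sqrt (J c) * (if t < \<bar>w n\<bar> then 1 else C / sqrt (J i))) * 2 ^ K"
proof -
  let ?I = "\<lambda>a. isolated_steps w \<tau> K a d"
  let ?y = "\<lambda>a S. position w d n $ a - 2 * (\<Sum>k\<in>S. w (3 * k + 2) * d (3 * k + 2) $ a)"
  define Q where "Q S \<longleftrightarrow> t < \<bar>w n\<bar> \<or> \<bar>?y i S\<bar> \<le> R + t" for S
  let ?\<gamma> = "if t < \<bar>w n\<bar> then 1 else C / sqrt (J i)"
  have J_pos: "0 < J a" for a by (simp add: J_def add_nonneg_pos)
  have dn: "d n \<in> directions" using direction_pathsD(2)[OF d] by simp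
  have dn0: "d n $ a = 0" if "a \<noteq> i" for a
    using direction_nth_unique[OF dn dni] that by blast
  have one_axis: "real (card {S \<in> Pow (?I a). \<bar>?y a S\<bar> \<le> B}) \<le> C / sqrt (J a) * 2 ^ card (?I a)"
    if "0 \<le> B" "B / \<tau> a + 1 \<le> C" for a B
  proof -
    have "0 < \<tau> a" using \<delta> by (simp add: \<tau>)
    from card_flips_one_axis[where \<tau> = \<tau> and a = a and w = w and t = "position w d n $ a",
        OF d K this that(1)]
    have "real (card {S \<in> Pow (?I a). \<bar>?y a S\<bar> \<le> B})
        \<le> ((B / \<tau> a + 1) / sqrt (J a)) * 2 ^ card (?I a)" by (simp add: J_def)
    also have "\<dots> \<le> C / sqrt (J a) * 2 ^ card (?I a)"
      using that J_pos[of a] by (intro mult_right_mono divide_right_mono) auto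
    finally show ?thesis .
  qed
  have sub: "?I b \<subseteq> {..<K}" "?I c \<subseteq> {..<K} - ?I b" "?I i \<subseteq> {..<K} - ?I b - ?I c"
    using isolated_steps_subset[of w \<tau> K _ d] isolated_steps_disjoint[OF d K, of _ _ w \<tau>] ibc by blast+
  have 1: "real (card {S \<in> Pow (?I i). Q S}) \<le> ?\<gamma> * 2 ^ card (?I i)"
  proof (cases "t < \<bar>w n\<bar>")
    case True
    have "card {S \<in> Pow (?I i). Q S} \<le> card (Pow (?I i))"
      by (intro card_mono) (auto intro: finite_subset[OF isolated_steps_subset])
    then have "real (card {S \<in> Pow (?I i). Q S}) \<le> real (2 ^ card (?I i))"
      by (simp only: of_nat_le_iff card_Pow finite_subset[OF isolated_steps_subset] finite_lessThan)
    then show ?thesis using True by simp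
  next
    case False
    have "(R + t) / \<tau> i + 1 \<le> C"
      using \<delta> \<open>0 \<le> R\<close> by (auto simp: C_def \<tau> add_divide_distrib intro!: divide_left_mono)
    then show ?thesis using False one_axis[of "R + t" i] \<delta> \<open>0 \<le> R\<close> by (simp add: Q_def)
  qed
  have 2: "real (card {S \<in> Pow ({..<K} - ?I b - ?I c). Q (S \<inter> ?I i) \<and> True}) \<le> ?\<gamma> * 1 * 2 ^ card ({..<K} - ?I b - ?I c)"
    by (rule card_Pow_disjoint_conditions[OF _ sub(3) 1]) (simp_all add: card_Pow flip: Pow_def)
  have RC: "R / \<tau> b + 1 \<le> C" "R / \<tau> c + 1 \<le> C" using ibc by (auto simp: C_def \<tau>)
  have 3: "real (card {S \<in> Pow ({..<K} - ?I b). \<bar>?y c (S \<inter> ?I c)\<bar> \<le> R \<and> Q ((S - ?I c) \<inter> ?I i)})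
      \<le> C / sqrt (J c) * ?\<gamma> * 2 ^ card ({..<K} - ?I b)"
    by (rule card_Pow_disjoint_conditions[OF _ sub(2) one_axis[OF \<open>0 \<le> R\<close> RC(2)]]) (use 2 in auto)
  have 4: "real (card {S \<in> Pow {..<K}. \<bar>?y b (S \<inter> ?I b)\<bar> \<le> R \<and>
        (\<bar>?y c ((S - ?I b) \<inter> ?I c)\<bar> \<le> R \<and> Q ((S - ?I b - ?I c) \<inter> ?I i))})
      \<le> C / sqrt (J b) * (C / sqrt (J c) * ?\<gamma>) * 2 ^ card {..<K}"
    by (rule card_Pow_disjoint_conditions[OF _ sub(1) one_axis[OF \<open>0 \<le> R\<close> RC(1)] 3]) auto
  have "{S \<in> Pow {..<K}. near_cube w R n (flip_steps w \<tau> K S d)}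
     \<subseteq> {S \<in> Pow {..<K}. \<bar>?y b (S \<inter> ?I b)\<bar> \<le> R \<and>
        (\<bar>?y c ((S - ?I b) \<inter> ?I c)\<bar> \<le> R \<and> Q ((S - ?I b - ?I c) \<inter> ?I i))}"
  proof (clarify, intro conjI)
    fix S assume "near_cube w R n (flip_steps w \<tau> K S d)"
    then have near: "\<bar>?y a (S \<inter> ?I a)\<bar> \<le> R + \<bar>w n\<bar> * \<bar>d n $ a\<bar>" for a
      unfolding near_cube_def position_flip[OF d K] flip_steps_last[OF K] by blast
    show "\<bar>?y b (S \<inter> ?I b)\<bar> \<le> R" using near[of b] dn0[of b] ibc by simp
    have "(S - ?I b) \<inter> ?I c = S \<inter> ?I c" using sub by blast
    then show "\<bar>?y c ((S - ?I b) \<inter> ?I c)\<bar> \<le> R" using near[of c] dn0[of c] ibc by simp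
    have "(S - ?I b - ?I c) \<inter> ?I i = S \<inter> ?I i" using sub by blast
    then show "Q ((S - ?I b - ?I c) \<inter> ?I i)"
      using near[of i] direction_nth_abs[OF dn dni] by (auto simp: Q_def)
  qed auto
  then have "card {S \<in> Pow {..<K}. near_cube w R n (flip_steps w \<tau> K S d)} \<le>
     card {S \<in> Pow {..<K}. \<bar>?y b (S \<inter> ?I b)\<bar> \<le> R \<and>
        (\<bar>?y c ((S - ?I b) \<inter> ?I c)\<bar> \<le> R \<and> Q ((S - ?I b - ?I c) \<inter> ?I i))}"
    by (intro card_mono) auto
  then show ?thesis using 4 by simp
qed

text \<open>
  Double counting of pairs of a path and a set of reversals: every set of reversals permutes
  the paths that have enough isolated steps on each of the three axes.
\<close>

lemma card_near_cube_paths: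
  fixes e0 :: "real ^ 'n" and i b c :: 'n and w :: "nat \<Rightarrow> real"
  assumes e0: "e0 \<in> directions" and K: "3 * K \<le> n"
    and \<delta>: "0 < \<delta>" "\<delta> \<le> t" and \<tau>: "\<tau> = (\<lambda>a. if a = i then t else \<delta>)" and "0 \<le> R"
    and ibc: "i \<noteq> b" "i \<noteq> c" "b \<noteq> c" and m: "0 < m" "0 < m'"
  defines "few \<equiv> \<lambda>a x. {d \<in> direction_paths e0 n. real (card (isolated_steps w \<tau> K a d)) < x}"
    and "C \<equiv> R / \<delta> + 2"
  shows "real (card {d \<in> direction_paths e0 n. d n $ i \<noteq> 0 \<and> near_cube w R n d})
    \<le> real (card (few b m)) + real (card (few c m)) + real (card (few i m'))
      + C\<^sup>2 / m * ((if t < \<bar>w n\<bar> then 1 else 0) + C / sqrt m') * real (card (direction_paths e0 n))"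
proof -
  let ?V = "direction_paths e0 n" and ?f = "flip_steps w \<tau> K"
  let ?J = "\<lambda>a d. real (card (isolated_steps w \<tau> K a d))"
  define G where "G = {d \<in> ?V. d n $ i \<noteq> 0 \<and> m \<le> ?J b d \<and> m \<le> ?J c d \<and> m' \<le> ?J i d}"
  let ?\<beta> = "C\<^sup>2 / m * ((if t < \<bar>w n\<bar> then 1 else 0) + C / sqrt m')"
  have finV: "finite ?V" by (rule finite_direction_paths[OF e0])
  have finG: "finite G" using finV by (simp add: G_def)
  have C: "0 \<le> C" using \<open>0 \<le> R\<close> \<delta> by (simp add: C_def)
  have G_flip: "?f S d \<in> G \<longleftrightarrow> d \<in> G" for S d
  proof -
    have "?f S d \<in> G" if "d \<in> G" for d
      using that flip_steps_in_direction_paths[OF _ K, of d e0 w \<tau> S] flip_steps_last[OF K, of w \<tau> S d]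
      by (auto simp: G_def)
    from this[of d] this[of "?f S d"] show ?thesis by auto
  qed
  have "real (card {S \<in> Pow {..<K}. near_cube w R n (?f S d)}) \<le> ?\<beta> * 2 ^ K" if "d \<in> G" for d
  proof -
    have dV: "d \<in> ?V" and dn: "d n $ i \<noteq> 0" and J: "m \<le> ?J b d" "m \<le> ?J c d" "m' \<le> ?J i d"
      using that by (auto simp: G_def)
    have s: "C / sqrt (?J b d + 1) \<le> C / sqrt m" "C / sqrt (?J c d + 1) \<le> C / sqrt m"
       "C / sqrt (?J i d + 1) \<le> C / sqrt m'"
      using J m C by (auto intro!: divide_left_mono mult_pos_pos add_nonneg_pos)
    have "real (card {S \<in> Pow {..<K}. near_cube w R n (?f S d)})
        \<le> C / sqrt (?J b d + 1) * (C / sqrt (?J c d + 1) *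
            (if t < \<bar>w n\<bar> then 1 else C / sqrt (?J i d + 1))) * 2 ^ K"
      unfolding C_def by (rule card_flips_near_cube[OF dV K \<delta> \<tau> \<open>0 \<le> R\<close> ibc dn])
    also have "\<dots> \<le> C / sqrt m * (C / sqrt m *
            ((if t < \<bar>w n\<bar> then 1 else 0) + C / sqrt m')) * 2 ^ K"
      using s C m by (intro mult_right_mono mult_mono) (auto intro!: add_nonneg_nonneg)
    also have "\<dots> = ?\<beta> * 2 ^ K" using m by (simp add: power2_eq_square)
    finally show ?thesis .
  qed
  note per_path = this
  have "2 ^ K * real (card {d \<in> G. near_cube w R n d})
      = (\<Sum>S\<in>Pow {..<K}. real (card {d \<in> G. near_cube w R n (?f S d)}))"
  proof -
    have "card {d \<in> G. near_cube w R n (?f S d)} = card {d \<in> G. near_cube w R n d}" for S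
      by (rule bij_betw_same_card[where f = "?f S"], rule bij_betwI[where g = "?f S"])
         (auto simp: G_flip)
    then show ?thesis by (simp add: card_Pow)
  qed
  also have "\<dots> = (\<Sum>S\<in>Pow {..<K}. \<Sum>d\<in>G. if near_cube w R n (?f S d) then 1 else 0)"
    using finG by (simp add: sum.If_cases Int_def)
  also have "\<dots> = (\<Sum>d\<in>G. \<Sum>S\<in>Pow {..<K}. if near_cube w R n (?f S d) then 1 else 0)"
    by (rule sum.swap)
  also have "\<dots> = (\<Sum>d\<in>G. real (card {S \<in> Pow {..<K}. near_cube w R n (?f S d)}))"
    by (simp add: sum.If_cases Int_def)
  also have "\<dots> \<le> (\<Sum>d\<in>G. ?\<beta> * 2 ^ K)" by (intro sum_mono per_path)
  also have "\<dots> = 2 ^ K * (?\<beta> * real (card G))" by simp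
  finally have "real (card {d \<in> G. near_cube w R n d}) \<le> ?\<beta> * real (card G)"
    by (simp only: mult_le_cancel_left_pos zero_less_power zero_less_numeral)
  also have "\<dots> \<le> ?\<beta> * real (card ?V)"
    using C m finV by (intro mult_left_mono) (auto simp: G_def intro!: card_mono mult_nonneg_nonneg)
  finally have good: "real (card {d \<in> G. near_cube w R n d}) \<le> ?\<beta> * real (card ?V)" .
  have "{d \<in> ?V. d n $ i \<noteq> 0 \<and> near_cube w R n d}
      \<subseteq> few b m \<union> few c m \<union> few i m' \<union> {d \<in> G. near_cube w R n d}"
    by (auto simp: few_def G_def)
  then have "card {d \<in> ?V. d n $ i \<noteq> 0 \<and> near_cube w R n d}
      \<le> card (few b m \<union> few c m \<union> few i m' \<union> {d \<in> G. near_cube w R n d})"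
    using finV finG by (intro card_mono) (auto simp: few_def)
  also have "\<dots> \<le> card (few b m) + card (few c m) + card (few i m') + card {d \<in> G. near_cube w R n d}"
    by (meson add_mono card_Un_le le_refl order_trans)
  finally have "real (card {d \<in> ?V. d n $ i \<noteq> 0 \<and> near_cube w R n d})
      \<le> real (card (few b m) + card (few c m) + card (few i m') + card {d \<in> G. near_cube w R n d})"
    by (simp only: of_nat_le_iff)
  then show ?thesis using good by simp
qed

section \<open>Paths with few isolated steps\<close>

lemma sum_le_card_minus:
  fixes f :: "'c \<Rightarrow> real"
  assumes "finite A" "y \<in> A" "f y \<le> B - e" "\<And>x. x \<in> A \<Longrightarrow> f x \<le> B"
  shows "sum f A \<le> real (card A) * B - e"
proof -
  have "sum f A = f y + sum f (A - {y})" by (rule sum.remove[OF assms(1,2)])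
  also have "\<dots> \<le> (B - e) + real (card (A - {y})) * B"
    using assms by (intro add_mono sum_bounded_above) auto
  also have "real (card (A - {y})) = real (card A) - 1"
    using assms by (simp add: card_Diff_singleton of_nat_diff Suc_leI card_gt_0_iff)
       (metis card_gt_0_iff empty_iff of_nat_1 of_nat_diff Suc_leI One_nat_def)
  finally show ?thesis by (simp add: algebra_simps)
qed

text \<open>
  From every direction \<open>u\<close> at least one of the \<open>N ^ 3\<close> continuations by three steps has its middle
  step isolated on the axis \<open>a\<close>. The proof exhibits it: a step \<open>s\<close> along another axis \<open>b\<close> with a sign that
  makes it differ from \<open>u\<close>, a step along \<open>a\<close>, and a step along \<open>b\<close>.
\<close>

lemma sum_three_steps_le:
  fixes u :: "real ^ 'n" and a :: 'n
  assumes u: "u \<in> directions" and "2 \<le> CARD('n)"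
  defines "N \<equiv> 2 * real CARD('n) - 1"
  shows "(\<Sum>v1\<in>directions - {u}. \<Sum>v2\<in>directions - {v1}. \<Sum>v3\<in>directions - {v2}.
      if v1 $ a = 0 \<and> v2 $ a \<noteq> 0 \<and> v3 $ a = 0 then 1 / 2 else 1) \<le> N ^ 3 * (1 - 1 / (2 * N ^ 3))"
proof -
  let ?g = "\<lambda>(v1 :: real ^ 'n) (v2 :: real ^ 'n) (v3 :: real ^ 'n). if v1 $ a = 0 \<and> v2 $ a \<noteq> 0 \<and> v3 $ a = 0 then 1 / 2 else 1 :: real"
  have N: "0 < N" using assms(2) by (simp add: N_def)
  have other: "real (card (directions - {v})) = N" if "v \<in> directions" for v :: "real ^ 'n"
    using card_other_directions[OF that] by (simp add: N_def)
  have "\<exists>b. b \<noteq> a"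
  proof (rule ccontr)
    assume "\<nexists>b. b \<noteq> a"
    then have "UNIV = {a}" by auto
    then have "CARD('n) = 1" by (metis card.empty card_insert_disjoint empty_iff finite.emptyI One_nat_def)
    then show False using assms(2) by simp
  qed
  then obtain b where b: "b \<noteq> a" by auto
  define s where "s = (if u = axis b 1 then - axis b 1 else axis b (1::real))"
  have s: "s \<in> directions" "s \<noteq> u" "s $ a = 0"
    using b axis_neq_uminus_axis[of b b] by (auto simp: s_def directions_iff axis_def)
  have t: "axis a 1 \<in> (directions :: (real ^ 'n) set)" "axis a (1::real) \<noteq> s" "axis a (1::real) $ a \<noteq> 0"
    using s(3) by (auto simp: directions_iff)
  have r: "axis b 1 \<in> (directions :: (real ^ 'n) set)" by (auto simp: directions_iff)
  have r': "axis b (1::real) \<noteq> axis a 1" "axis b (1::real) $ a = 0"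
    using b by (simp_all add: axis_eq_axis) (simp add: axis_def)
  have i3: "(\<Sum>v3\<in>directions - {v2}. ?g v1 v2 v3) \<le> N" if "v2 \<in> directions" for v1 v2
    using sum_bounded_above[of "directions - {v2}" "?g v1 v2" 1] other[OF that] by auto
  have "(\<Sum>v3\<in>directions - {axis a 1}. ?g s (axis a 1) v3)
      \<le> real (card (directions - {axis a 1 :: real ^ 'n})) * 1 - 1 / 2"
    using s t r r' by (intro sum_le_card_minus[where y = "axis b (1::real)"]) auto
  then have s3: "(\<Sum>v3\<in>directions - {axis a 1}. ?g s (axis a 1) v3) \<le> N - 1 / 2"
    using other[OF t(1)] by simp
  have i2: "(\<Sum>v2\<in>directions - {v1}. \<Sum>v3\<in>directions - {v2}. ?g v1 v2 v3) \<le> N * N"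
    if "v1 \<in> directions" for v1
    using sum_bounded_above[of "directions - {v1}" "\<lambda>v2. \<Sum>v3\<in>directions - {v2}. ?g v1 v2 v3" N]
      other[OF that] i3 by auto
  have "(\<Sum>v2\<in>directions - {s}. \<Sum>v3\<in>directions - {v2}. ?g s v2 v3)
      \<le> real (card (directions - {s})) * N - 1 / 2"
    using s t by (intro sum_le_card_minus[where y = "axis a (1::real)"] s3 i3) auto
  then have s2: "(\<Sum>v2\<in>directions - {s}. \<Sum>v3\<in>directions - {v2}. ?g s v2 v3) \<le> N * N - 1 / 2"
    using other[OF s(1)] by simp
  have "(\<Sum>v1\<in>directions - {u}. \<Sum>v2\<in>directions - {v1}. \<Sum>v3\<in>directions - {v2}. ?g v1 v2 v3)
      \<le> real (card (directions - {u})) * (N * N) - 1 / 2"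
    using s by (intro sum_le_card_minus[where y = s] s2 i2) auto
  also have "\<dots> = N ^ 3 * (1 - 1 / (2 * N ^ 3))"
    using N other[OF u] by (simp add: field_simps power3_eq_cube)
  finally show ?thesis .
qed

lemma isolated_steps_cong:
  assumes "\<And>j. j \<le> 3 * K \<Longrightarrow> d j = d' j"
  shows "isolated_steps w \<tau> K a d = isolated_steps w \<tau> K a d'"
  using assms by (auto simp: isolated_steps_def)

lemma isolated_steps_Suc:
  "isolated_steps w \<tau> (Suc K) a d = isolated_steps w \<tau> K a d \<union>
     (if d (3 * K + 1) $ a = 0 \<and> d (3 * K + 2) $ a \<noteq> 0 \<and> d (3 * K + 3) $ a = 0 \<and>
         \<tau> a \<le> \<bar>w (3 * K + 2)\<bar> then {K} else {})"
  unfolding isolated_steps_def lessThan_Suc by auto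

lemma sum_half_power_isolated:
  fixes e0 :: "real ^ 'n" and a :: 'n
  assumes e0: "e0 \<in> directions" and "2 \<le> CARD('n)"
  defines "N \<equiv> 2 * real CARD('n) - 1"
  shows "(\<Sum>d\<in>direction_paths e0 (3 * K). (1 / 2) ^ card (isolated_steps w \<tau> K a d))
     \<le> N ^ (3 * K) * (\<Prod>k<K. if \<tau> a \<le> \<bar>w (3 * k + 2)\<bar> then 1 - 1 / (2 * N ^ 3) else 1)"
proof (induction K)
  case 0
  then show ?case by (simp add: direction_paths_0[OF e0] isolated_steps_def)
next
  case (Suc K)
  let ?V = "direction_paths e0 (3 * K)" and ?p = "\<lambda>d. (1 / 2 :: real) ^ card (isolated_steps w \<tau> K a d)"
  let ?r = "if \<tau> a \<le> \<bar>w (3 * K + 2)\<bar> then 1 - 1 / (2 * N ^ 3) else 1"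
  let ?h = "\<lambda>(v1 :: real ^ 'n) (v2 :: real ^ 'n) (v3 :: real ^ 'n). if v1 $ a = 0 \<and> v2 $ a \<noteq> 0 \<and> v3 $ a = 0 \<and> \<tau> a \<le> \<bar>w (3 * K + 2)\<bar>
      then 1 / 2 else 1 :: real"
  have N: "0 < N" using assms(2) by (simp add: N_def)
  have other: "real (card (directions - {v})) = N" if "v \<in> directions" for v :: "real ^ 'n"
    using card_other_directions[OF that] by (simp add: N_def)
  have step: "(1 / 2) ^ card (isolated_steps w \<tau> (Suc K) a (d(Suc (3 * K) := v1, Suc (Suc (3 * K)) := v2,
      Suc (Suc (Suc (3 * K))) := v3))) = ?p d * ?h v1 v2 v3" for d v1 v2 v3
  proof -
    let ?d = "d(Suc (3 * K) := v1, Suc (Suc (3 * K)) := v2, Suc (Suc (Suc (3 * K))) := v3)"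
    let ?c = "v1 $ a = 0 \<and> v2 $ a \<noteq> 0 \<and> v3 $ a = 0 \<and> \<tau> a \<le> \<bar>w (3 * K + 2)\<bar>"
    have "isolated_steps w \<tau> (Suc K) a ?d
        = isolated_steps w \<tau> K a ?d \<union> (if ?c then {K} else {})"
      unfolding isolated_steps_Suc[of w \<tau> K a ?d] by (simp add: numeral_3_eq_3)
    also have "isolated_steps w \<tau> K a ?d = isolated_steps w \<tau> K a d"
      by (rule isolated_steps_cong) auto
    finally have eq: "isolated_steps w \<tau> (Suc K) a ?d
        = isolated_steps w \<tau> K a d \<union> (if ?c then {K} else {})" .
    have "K \<notin> isolated_steps w \<tau> K a d" "finite (isolated_steps w \<tau> K a d)"
      using isolated_steps_subset[of w \<tau> K a d] by (auto intro: finite_subset)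
    then show ?thesis unfolding eq by simp
  qed
  have block: "(\<Sum>v1\<in>directions - {u}. \<Sum>v2\<in>directions - {v1}. \<Sum>v3\<in>directions - {v2}. ?h v1 v2 v3)
      \<le> N ^ 3 * ?r" if "u \<in> directions" for u :: "real ^ 'n"
  proof (cases "\<tau> a \<le> \<bar>w (3 * K + 2)\<bar>")
    case True
    then show ?thesis using sum_three_steps_le[OF that assms(2), of a] by (simp add: N_def)
  next
    case False
    moreover have "real (card (directions :: (real ^ 'n) set) - Suc 0) = N"
      using other[OF that] that by simp
    ultimately show ?thesis using that by (simp add: power3_eq_cube)
  qed
  have "3 * Suc K = Suc (Suc (Suc (3 * K)))" by simp
  then have "(\<Sum>d\<in>direction_paths e0 (3 * Suc K). (1 / 2) ^ card (isolated_steps w \<tau> (Suc K) a d))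
    = (\<Sum>d\<in>?V. \<Sum>v1\<in>directions - {d (3 * K)}. \<Sum>v2\<in>directions - {v1}. \<Sum>v3\<in>directions - {v2}.
        ?p d * ?h v1 v2 v3)"
    by (simp only: sum_direction_paths_Suc[OF e0] step fun_upd_same)
  also have "\<dots> = (\<Sum>d\<in>?V. ?p d * (\<Sum>v1\<in>directions - {d (3 * K)}. \<Sum>v2\<in>directions - {v1}.
      \<Sum>v3\<in>directions - {v2}. ?h v1 v2 v3))"
    by (simp only: sum_distrib_left)
  also have "\<dots> \<le> (\<Sum>d\<in>?V. ?p d * (N ^ 3 * ?r))"
    by (intro sum_mono mult_left_mono block direction_pathsD(2)) auto
  also have "\<dots> = (\<Sum>d\<in>?V. ?p d) * (N ^ 3 * ?r)" by (simp only: sum_distrib_right)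
  also have "\<dots> \<le> (N ^ (3 * K) * (\<Prod>k<K. if \<tau> a \<le> \<bar>w (3 * k + 2)\<bar> then 1 - 1 / (2 * N ^ 3) else 1))
      * (N ^ 3 * ?r)"
  proof (rule mult_right_mono[OF Suc.IH])
    have "1 \<le> N ^ 3" using assms(2) by (intro one_le_power) (simp add: N_def)
    then have "1 / (2 * N ^ 3) \<le> 1" using N by (simp add: divide_le_eq)
    then show "0 \<le> N ^ 3 * ?r" using N by auto
  qed
  also have "\<dots> = N ^ (3 * Suc K) *
      (\<Prod>k<Suc K. if \<tau> a \<le> \<bar>w (3 * k + 2)\<bar> then 1 - 1 / (2 * N ^ 3) else 1)"
    unfolding mult_Suc_right power_add prod.lessThan_Suc by (simp only: mult_ac)
  finally show ?case .
qed

text \<open>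
  A Chernoff bound, with the generating function of the number of isolated steps evaluated at
  \<open>1 / 2\<close>. The product on the right-hand side depends on the waiting times only.
\<close>

lemma card_few_isolated_steps:
  fixes e0 :: "real ^ 'n" and a :: 'n
  assumes e0: "e0 \<in> directions" and "2 \<le> CARD('n)" and K: "3 * K \<le> n"
  defines "N \<equiv> 2 * real CARD('n) - 1"
  shows "real (card {d \<in> direction_paths e0 n. real (card (isolated_steps w \<tau> K a d)) < x})
     \<le> exp x * (\<Prod>k<K. if \<tau> a \<le> \<bar>w (3 * k + 2)\<bar> then 1 - 1 / (2 * N ^ 3) else 1)
        * real (card (direction_paths e0 n))"
proof -
  let ?J = "isolated_steps w \<tau> K a"
  let ?\<rho> = "\<Prod>k<K. if \<tau> a \<le> \<bar>w (3 * k + 2)\<bar> then 1 - 1 / (2 * N ^ 3) else 1"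
  have half: "(\<Sum>d\<in>direction_paths e0 (3 * K + r). (1 / 2) ^ card (?J d)) \<le> N ^ (3 * K + r) * ?\<rho>" for r
  proof (induction r)
    case 0
    then show ?case using sum_half_power_isolated[where w = w and \<tau> = \<tau> and a = a and K = K, OF e0 assms(2)] unfolding N_def by simp
  next
    case (Suc r)
    have "(\<Sum>d\<in>direction_paths e0 (3 * K + Suc r). (1 / 2) ^ card (?J d))
      = (\<Sum>d\<in>direction_paths e0 (3 * K + r). \<Sum>v\<in>directions - {d (3 * K + r)}.
          (1 / 2) ^ card (?J (d(Suc (3 * K + r) := v))))"
      by (simp only: sum_direction_paths_Suc[OF e0] add_Suc_right)
    also have "\<dots> = (\<Sum>d\<in>direction_paths e0 (3 * K + r). \<Sum>v\<in>directions - {d (3 * K + r)}.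
          (1 / 2) ^ card (?J d))"
      by (intro sum.cong refl arg_cong[where f = "\<lambda>A. (1 / 2) ^ card A"] isolated_steps_cong) auto
    also have "\<dots> = (\<Sum>d\<in>direction_paths e0 (3 * K + r). N * (1 / 2) ^ card (?J d))"
    proof (intro sum.cong refl)
      fix d assume "d \<in> direction_paths e0 (3 * K + r)"
      then have "real (card (directions - {d (3 * K + r)})) = N"
        unfolding N_def by (intro card_other_directions direction_pathsD(2)) auto
      then show "(\<Sum>v\<in>directions - {d (3 * K + r)}. (1 / 2) ^ card (?J d)) = N * (1 / 2) ^ card (?J d)"
        by (simp only: sum_constant)
    qed
    also have "\<dots> = N * (\<Sum>d\<in>direction_paths e0 (3 * K + r). (1 / 2) ^ card (?J d))"
      by (simp only: sum_distrib_left)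
    also have "\<dots> \<le> N * (N ^ (3 * K + r) * ?\<rho>)"
      using assms(2) by (intro mult_left_mono Suc.IH) (simp add: N_def)
    finally show ?case by simp
  qed
  have fin: "finite (direction_paths e0 n)" by (rule finite_direction_paths[OF e0])
  have "real (card {d \<in> direction_paths e0 n. real (card (?J d)) < x})
      = (\<Sum>d\<in>direction_paths e0 n. if real (card (?J d)) < x then 1 else 0)"
    using fin by (simp add: sum.If_cases Int_def)
  also have "\<dots> \<le> (\<Sum>d\<in>direction_paths e0 n. exp x * (1 / 2) ^ card (?J d))"
  proof (rule sum_mono)
    fix d
    have "exp (- real (card (?J d))) = exp (- 1) ^ card (?J d)"
      by (simp add: exp_of_nat_mult[symmetric])
    also have "\<dots> \<le> (1 / 2) ^ card (?J d)"
      using exp_ge_add_one_self[of 1] by (intro power_mono) (auto simp: exp_minus field_simps)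
    finally have "exp x * exp (- real (card (?J d))) \<le> exp x * (1 / 2) ^ card (?J d)" by simp
    moreover have "1 \<le> exp x * exp (- real (card (?J d)))" if "real (card (?J d)) < x"
      using that by (simp add: exp_add[symmetric])
    ultimately show "(if real (card (?J d)) < x then 1 else 0) \<le> exp x * (1 / 2) ^ card (?J d)"
      by (auto intro: order_trans)
  qed
  also have "\<dots> = exp x * (\<Sum>d\<in>direction_paths e0 n. (1 / 2) ^ card (?J d))"
    by (simp only: sum_distrib_left)
  also have "\<dots> \<le> exp x * (N ^ n * ?\<rho>)"
    using half[of "n - 3 * K"] K by (intro mult_left_mono) auto
  finally show ?thesis by (simp add: card_direction_paths[OF e0] N_def mult_ac)
qed

section \<open>The joint law of directions and waiting times\<close>

context directionally_reinforced_walk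
begin

lemma history_event:
  assumes "I \<subseteq> {..m}" "\<And>k. k \<in> I \<Longrightarrow> d k \<in> directions" "\<And>k. B k \<in> sets borel"
  shows "{\<omega> \<in> space M. (\<forall>k\<in>I. D k \<omega> = d k) \<and> (\<forall>k\<in>{..<l}. W k \<omega> \<in> B k)} \<in> history M D W m l"
proof -
  let ?G = "(\<Union>k\<in>{..m}. sets (vimage_algebra (space M) (D k) (count_space directions))) \<union>
      (\<Union>k\<in>{..<l}. sets (vimage_algebra (space M) (W k) borel))"
  define H where "H = sigma (space M) ?G"
  have "?G \<subseteq> Pow (space M)"
    using sets.sets_into_space by (fastforce simp: space_vimage_algebra)
  then have sets_H: "sets H = history M D W m l" and space_H: "space H = space M" and G: "?G \<subseteq> sets H"
    by (auto simp: H_def history_def)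
  have "{\<omega> \<in> space H. D k \<omega> = d k} \<in> sets H" if "k \<in> I" for k
  proof -
    have "D k -` {d k} \<inter> space M \<in> sets (vimage_algebra (space M) (D k) (count_space directions))"
      using assms(2)[OF that] by (intro in_vimage_algebra) auto
    moreover have "k \<in> {..m}" using that assms(1) by auto
    ultimately have "D k -` {d k} \<inter> space M \<in> sets H" using G by blast
    moreover have "D k -` {d k} \<inter> space M = {\<omega> \<in> space H. D k \<omega> = d k}" by (auto simp: space_H)
    ultimately show ?thesis by simp
  qed
  moreover have "{\<omega> \<in> space H. W k \<omega> \<in> B k} \<in> sets H" if "k \<in> {..<l}" for k
  proof -
    have "W k -` B k \<inter> space M \<in> sets (vimage_algebra (space M) (W k) borel)"
      using assms(3) by (rule in_vimage_algebra)
    then have "W k -` B k \<inter> space M \<in> sets H" using G that by blast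
    moreover have "W k -` B k \<inter> space M = {\<omega> \<in> space H. W k \<omega> \<in> B k}" by (auto simp: space_H)
    ultimately show ?thesis by simp
  qed
  moreover have "finite I" using assms(1) by (rule finite_subset) simp
  ultimately have "{\<omega> \<in> space H. (\<forall>k\<in>I. D k \<omega> = d k) \<and> (\<forall>k\<in>{..<l}. W k \<omega> \<in> B k)} \<in> sets H"
    by (intro sets.sets_Collect_conj sets.sets_Collect_finite_All) auto
  then show ?thesis by (simp only: sets_H space_H)
qed

lemma prob_next_waiting_time:
  assumes "A \<in> history M D W n n" "B \<in> sets borel"
  shows "prob (A \<inter> {\<omega> \<in> space M. W n \<omega> \<in> B}) = prob A * measure \<mu> B"
proof -
  have eq: "W n -` B \<inter> space M = {\<omega> \<in> space M. W n \<omega> \<in> B}" by auto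
  have "prob (A \<inter> (W n -` B \<inter> space M)) = prob A * prob (W n -` B \<inter> space M)"
    by (rule indep_setD[OF waiting_time_indep assms(1) in_vimage_algebra[OF assms(2)]])
  moreover have "prob (W n -` B \<inter> space M) = measure \<mu> B"
    unfolding waiting_time_distr[of n, symmetric]
    by (rule measure_distr[symmetric]) (use waiting_time_measurable assms in auto)
  ultimately show ?thesis by (simp only: eq)
qed

lemma prob_waiting_times:
  assumes "\<And>k. B k \<in> sets borel"
  shows "prob {\<omega> \<in> space M. \<forall>k\<in>{..<n}. W k \<omega> \<in> B k} = (\<Prod>k<n. measure \<mu> (B k))"
proof (induction n)
  case 0
  then show ?case by (simp add: prob_space)
next
  case (Suc n)
  let ?A = "{\<omega> \<in> space M. \<forall>k\<in>{..<n}. W k \<omega> \<in> B k}"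
  have "?A \<in> history M D W n n" using history_event[of "{}" n undefined B n] assms by simp
  from prob_next_waiting_time[OF this assms[of n]]
  have "prob (?A \<inter> {\<omega> \<in> space M. W n \<omega> \<in> B n}) = (\<Prod>k<Suc n. measure \<mu> (B k))"
    using Suc.IH by simp
  also have "?A \<inter> {\<omega> \<in> space M. W n \<omega> \<in> B n} = {\<omega> \<in> space M. \<forall>k\<in>{..<Suc n}. W k \<omega> \<in> B k}"
    by (auto simp: less_Suc_eq)
  finally show ?case .
qed

lemma prob_path_waiting_times:
  fixes d :: "nat \<Rightarrow> real ^ 'n"
  assumes "d 0 = e0" "\<And>k. k \<le> n \<Longrightarrow> d k \<in> directions" "\<And>k. k < n \<Longrightarrow> d (Suc k) \<noteq> d k"
    and B: "\<And>k. B k \<in> sets borel"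
  shows "prob {\<omega> \<in> space M. (\<forall>k\<in>{..n}. D k \<omega> = d k) \<and> (\<forall>k\<in>{..<Suc n}. W k \<omega> \<in> B k)}
    = (\<Prod>k<Suc n. measure \<mu> (B k)) / (2 * real CARD('n) - 1) ^ n"
  using assms(1-3)
proof (induction n)
  case 0
  let ?A = "{\<omega> \<in> space M. (\<forall>k\<in>{..0}. D k \<omega> = d k) \<and> (\<forall>k\<in>{..<0}. W k \<omega> \<in> B k)}"
  have A: "?A \<in> history M D W 0 0" using 0 by (intro history_event B) auto
  have "{\<omega> \<in> space M. D 0 \<omega> = e0} \<in> events"
    using measurable_sets[OF direction_measurable[of 0], of "{e0}"] 0(1) 0(2)[of 0]
    by (simp add: vimage_def Int_def conj_commute)
  then have "prob ?A = 1" using initial_direction 0(1) by (simp add: prob_Collect_eq_1)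
  moreover have "{\<omega> \<in> space M. (\<forall>k\<in>{..0}. D k \<omega> = d k) \<and> (\<forall>k\<in>{..<Suc 0}. W k \<omega> \<in> B k)}
      = ?A \<inter> {\<omega> \<in> space M. W 0 \<omega> \<in> B 0}" by auto
  ultimately show ?case using prob_next_waiting_time[OF A B, of 0] by simp
next
  case (Suc n)
  let ?N = "2 * real CARD('n) - 1"
  let ?A = "{\<omega> \<in> space M. (\<forall>k\<in>{..n}. D k \<omega> = d k) \<and> (\<forall>k\<in>{..<Suc n}. W k \<omega> \<in> B k)}"
  let ?A' = "{\<omega> \<in> space M. (\<forall>k\<in>{..Suc n}. D k \<omega> = d k) \<and> (\<forall>k\<in>{..<Suc n}. W k \<omega> \<in> B k)}"
  have IH: "prob ?A = (\<Prod>k<Suc n. measure \<mu> (B k)) / ?N ^ n" using Suc by simp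
  have "?A \<in> history M D W n (Suc n)" using Suc.prems by (intro history_event B) auto
  from direction_step[OF this, of "d n" "d (Suc n)"]
  have "prob (?A \<inter> {\<omega> \<in> space M. D n \<omega> = d n \<and> D (Suc n) \<omega> = d (Suc n)})
     = prob (?A \<inter> {\<omega> \<in> space M. D n \<omega> = d n}) / ?N" using Suc.prems by simp
  moreover have "?A \<inter> {\<omega> \<in> space M. D n \<omega> = d n \<and> D (Suc n) \<omega> = d (Suc n)} = ?A'"
    by (auto simp: le_Suc_eq)
  moreover have "?A \<inter> {\<omega> \<in> space M. D n \<omega> = d n} = ?A" by auto
  ultimately have A': "prob ?A' = (\<Prod>k<Suc n. measure \<mu> (B k)) / ?N ^ Suc n"
    using IH by (simp add: mult.commute)
  have "?A' \<in> history M D W (Suc n) (Suc n)" using Suc.prems by (intro history_event B) auto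
  from prob_next_waiting_time[OF this B[of "Suc n"]]
  have "prob (?A' \<inter> {\<omega> \<in> space M. W (Suc n) \<omega> \<in> B (Suc n)})
      = (\<Prod>k<Suc (Suc n). measure \<mu> (B k)) / ?N ^ Suc n"
    unfolding A' by simp
  also have "?A' \<inter> {\<omega> \<in> space M. W (Suc n) \<omega> \<in> B (Suc n)}
      = {\<omega> \<in> space M. (\<forall>k\<in>{..Suc n}. D k \<omega> = d k) \<and> (\<forall>k\<in>{..<Suc (Suc n)}. W k \<omega> \<in> B k)}"
    by (auto simp: less_Suc_eq)
  finally show ?case .
qed

lemma indep_waiting_times: "indep_vars (\<lambda>_. borel) W UNIV"
proof -
  have measure_\<mu>: "measure \<mu> B = prob (W k -` B \<inter> space M)" if "B \<in> sets borel" for B k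
    unfolding waiting_time_distr[of k, symmetric]
    by (rule measure_distr) (use waiting_time_measurable that in auto)
  have "prob (\<Inter>j\<in>J. A j) = (\<Prod>j\<in>J. prob (A j))"
    if J: "J \<noteq> {}" "finite J" and A: "\<forall>j\<in>J. A j \<in> {W j -` B \<inter> space M |B. B \<in> sets borel}" for J A
  proof -
    from A obtain B where B: "\<And>j. j \<in> J \<Longrightarrow> A j = W j -` B j \<inter> space M \<and> B j \<in> sets borel"
      by (auto simp: Bex_def) metis
    define B' where "B' k = (if k \<in> J then B k else UNIV)" for k
    have B': "B' k \<in> sets borel" for k using B by (simp add: B'_def)
    define n where "n = Suc (Max J)"
    have J_n: "J \<subseteq> {..<n}" using J by (auto simp: n_def less_Suc_eq_le)
    have "measure \<mu> UNIV = 1" using measure_\<mu>[of UNIV 0] by (simp add: prob_space)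
    then have "(\<Prod>k<n. measure \<mu> (B' k)) = (\<Prod>k\<in>J. measure \<mu> (B' k))"
      using J_n by (intro prod.mono_neutral_right) (auto simp: B'_def)
    also have "\<dots> = (\<Prod>k\<in>J. prob (A k))"
      using B measure_\<mu> by (intro prod.cong) (auto simp: B'_def)
    finally have "prob {\<omega> \<in> space M. \<forall>k\<in>{..<n}. W k \<omega> \<in> B' k} = (\<Prod>k\<in>J. prob (A k))"
      using prob_waiting_times[of B' n] B' by simp
    also have "{\<omega> \<in> space M. \<forall>k\<in>{..<n}. W k \<omega> \<in> B' k} = (\<Inter>j\<in>J. A j)"
      using J J_n B by (auto simp: B'_def split: if_splits)
    finally show ?thesis .
  qed
  moreover have "{W j -` B \<inter> space M |B. B \<in> sets borel} \<subseteq> events" for j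
    using waiting_time_measurable by (auto intro: measurable_sets)
  ultimately have "indep_sets (\<lambda>j. {W j -` B \<inter> space M |B. B \<in> sets borel}) UNIV"
    by (intro indep_setsI)
  then show ?thesis by (simp add: indep_vars_def2 waiting_time_measurable)
qed

text \<open>
  Each path of directions of length \<open>n\<close> has probability \<open>1 / (2 * CARD('n) - 1) ^ n\<close> and is independent of
  all events that are determined by the waiting times \<open>W 0, \<dots>, W n\<close>. The hypothesis on \<open>F\<close> expresses
  that the event is of this kind: it is measurable for every \<open>\<sigma>\<close>-algebra on \<open>space M\<close> for which these
  waiting times are measurable.
\<close>

lemma prob_path_and_waiting_event:
  fixes d :: "nat \<Rightarrow> real ^ 'n" and n :: nat
  assumes d: "d \<in> direction_paths e0 n"
    and F: "\<And>H. space H = space M \<Longrightarrow> (\<And>k. k \<le> n \<Longrightarrow> W k \<in> borel_measurable H) \<Longrightarrow>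
      {\<omega> \<in> space H. F (\<lambda>k. W k \<omega>)} \<in> sets H"
  shows "prob {\<omega> \<in> space M. (\<forall>k\<in>{..n}. D k \<omega> = d k) \<and> F (\<lambda>k. W k \<omega>)}
     = prob {\<omega> \<in> space M. F (\<lambda>k. W k \<omega>)} / (2 * real CARD('n) - 1) ^ n"
proof -
  let ?N = "2 * real CARD('n) - 1"
  let ?P = "{\<omega> \<in> space M. \<forall>k\<in>{..n}. D k \<omega> = d k}"
  let ?R = "\<lambda>B. {\<omega> \<in> space M. \<forall>k\<in>{..<Suc n}. W k \<omega> \<in> B k}"
  define R where "R = {?R B |B. \<forall>k. B k \<in> sets borel}"
  note prob_joint = prob_path_waiting_times[OF direction_pathsD(1-3)[OF d]]
  have \<mu>1: "measure \<mu> UNIV = 1"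
    using prob_next_waiting_time[of "space M" 0 UNIV] history_event[of "{}" 0 undefined "\<lambda>_. UNIV" 0]
    by (simp add: prob_space)
  have prob_P: "prob ?P = 1 / ?N ^ n"
    using prob_joint[where B = "\<lambda>_. UNIV"] by (simp add: \<mu>1)
  have events_D: "?P \<in> events"
  proof -
    have "{\<omega> \<in> space M. D k \<omega> = d k} \<in> events" if "k \<in> {..n}" for k
      using measurable_sets[OF direction_measurable[of k], of "{d k}"] direction_pathsD(2)[OF d, of k] that
      by (simp add: vimage_def Int_def conj_commute)
    then show ?thesis by (intro sets.sets_Collect_finite_All) auto
  qed
  have R_events: "R \<subseteq> events"
  proof -
    have "{\<omega> \<in> space M. W k \<omega> \<in> B} \<in> events" if "B \<in> sets borel" for k B
      using measurable_sets[OF waiting_time_measurable that, of k]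
      by (simp add: vimage_def Int_def conj_commute)
    then show ?thesis unfolding R_def by (auto intro!: sets.sets_Collect_finite_All)
  qed
  have "Int_stable R"
  proof (rule Int_stableI)
    fix a b assume "a \<in> R" "b \<in> R"
    then obtain A B where AB: "a = ?R A" "b = ?R B" "\<forall>k. A k \<in> sets borel" "\<forall>k. B k \<in> sets borel"
      by (auto simp: R_def)
    then have "a \<inter> b = ?R (\<lambda>k. A k \<inter> B k)" by auto
    then show "a \<inter> b \<in> R" using AB unfolding R_def by (intro CollectI exI[of _ "\<lambda>k. A k \<inter> B k"]) auto
  qed
  moreover have "Int_stable {?P}" by (simp add: Int_stable_def)
  moreover have "indep_set {?P} R"
    unfolding indep_sets2_eq
  proof (intro conjI ballI)
    fix a b assume "a \<in> {?P}" "b \<in> R"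
    then obtain B where B: "a = ?P" "b = ?R B" "\<forall>k. B k \<in> sets borel" by (auto simp: R_def)
    have "a \<inter> b = {\<omega> \<in> space M. (\<forall>k\<in>{..n}. D k \<omega> = d k) \<and> (\<forall>k\<in>{..<Suc n}. W k \<omega> \<in> B k)}"
      using B by auto
    then show "prob (a \<inter> b) = prob a * prob b"
      using prob_joint[where B = B] prob_waiting_times[of B "Suc n"] B prob_P by simp
  qed (use events_D R_events in auto)
  ultimately have indep: "indep_set (sigma_sets (space M) {?P}) (sigma_sets (space M) R)"
    by (intro indep_set_sigma_sets)
  define H where "H = sigma (space M) R"
  have "R \<subseteq> Pow (space M)" by (auto simp: R_def)
  then have H: "sets H = sigma_sets (space M) R" "space H = space M" by (auto simp: H_def)
  have "W k \<in> borel_measurable H" if "k \<le> n" for k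
  proof (rule measurableI)
    fix B :: "real set" assume "B \<in> sets borel"
    then have "?R (\<lambda>j. if j = k then B else UNIV) \<in> R"
      unfolding R_def by (intro CollectI exI[of _ "\<lambda>j. if j = k then B else UNIV"]) auto
    moreover have "?R (\<lambda>j. if j = k then B else UNIV) = W k -` B \<inter> space H"
      using that by (auto simp: H split: if_splits)
    ultimately show "W k -` B \<inter> space H \<in> sets H" unfolding H(1) by (metis sigma_sets.Basic)
  qed simp
  from F[OF H(2) this] have "{\<omega> \<in> space M. F (\<lambda>k. W k \<omega>)} \<in> sigma_sets (space M) R"
    by (simp add: H)
  from indep_setD[OF indep sigma_sets.Basic this]
  have "prob (?P \<inter> {\<omega> \<in> space M. F (\<lambda>k. W k \<omega>)}) = prob ?P * prob {\<omega> \<in> space M. F (\<lambda>k. W k \<omega>)}"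
    by simp
  moreover have "?P \<inter> {\<omega> \<in> space M. F (\<lambda>k. W k \<omega>)}
      = {\<omega> \<in> space M. (\<forall>k\<in>{..n}. D k \<omega> = d k) \<and> F (\<lambda>k. W k \<omega>)}" by auto
  ultimately show ?thesis using prob_P by simp
qed

lemma near_cube_measurable:
  assumes "\<And>k. k \<le> n \<Longrightarrow> (\<lambda>\<omega>. w \<omega> k) \<in> borel_measurable H"
    "\<And>k a. k \<le> n \<Longrightarrow> (\<lambda>\<omega>. d \<omega> k $ a) \<in> borel_measurable H"
  shows "{\<omega> \<in> space H. near_cube (w \<omega>) R n (d \<omega> :: nat \<Rightarrow> real ^ 'n)} \<in> sets H"
proof -
  have "(\<lambda>\<omega>. w \<omega> n) \<in> borel_measurable H" by (rule assms) simp
  moreover have "(\<lambda>\<omega>. d \<omega> n $ a) \<in> borel_measurable H" for a by (rule assms) simp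
  moreover have "(\<lambda>\<omega>. \<Sum>k<n. w \<omega> k * d \<omega> k $ a) \<in> borel_measurable H" for a
    using assms by (intro borel_measurable_sum borel_measurable_times) auto
  ultimately have "{\<omega> \<in> space H. \<bar>\<Sum>k<n. w \<omega> k * d \<omega> k $ a\<bar> \<le> R + \<bar>w \<omega> n\<bar> * \<bar>d \<omega> n $ a\<bar>} \<in> sets H" for a
    by measurable
  then show ?thesis
    unfolding near_cube_def position_def by (simp add: sets.sets_Collect_finite_All')
qed

lemma direction_nth_measurable: "(\<lambda>\<omega>. D k \<omega> $ a) \<in> borel_measurable M"
  by (rule measurable_compose[OF direction_measurable]) simp

text \<open>
  Averaging over the directions before the waiting times.
\<close>

lemma prob_near_cube_le:
  assumes e0: "e0 \<in> directions"
  shows "prob {\<omega> \<in> space M. near_cube (\<lambda>k. W k \<omega>) R n (\<lambda>k. D k \<omega>)}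
    \<le> expectation (\<lambda>\<omega>. real (card {d \<in> direction_paths e0 n. near_cube (\<lambda>k. W k \<omega>) R n d})
        / real (card (direction_paths e0 n)))"
proof -
  let ?V = "direction_paths e0 n" and ?N = "2 * real CARD('n) - 1"
  let ?E = "{\<omega> \<in> space M. near_cube (\<lambda>k. W k \<omega>) R n (\<lambda>k. D k \<omega>)}"
  let ?P = "\<lambda>d :: nat \<Rightarrow> real ^ 'n. {\<omega> \<in> space M. \<forall>k\<in>{..n}. D k \<omega> = d k}"
  let ?Q = "\<lambda>d :: nat \<Rightarrow> real ^ 'n. {\<omega> \<in> space M. near_cube (\<lambda>k. W k \<omega>) R n d}"
  let ?PQ = "\<lambda>d :: nat \<Rightarrow> real ^ 'n. {\<omega> \<in> space M. (\<forall>k\<in>{..n}. D k \<omega> = d k) \<and> near_cube (\<lambda>k. W k \<omega>) R n d}"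
  have finV: "finite ?V" by (rule finite_direction_paths[OF e0])
  have N: "2 * real CARD('n) \<noteq> 1" using zero_less_card_finite[where 'a = 'n] by linarith
  have cardV: "real (card ?V) = ?N ^ n" by (rule card_direction_paths[OF e0])
  have [measurable]: "?Q d \<in> events" for d :: "nat \<Rightarrow> real ^ 'n"
    by (rule near_cube_measurable[where w = "\<lambda>\<omega> k. W k \<omega>" and d = "\<lambda>_. d"])
      (auto intro: waiting_time_measurable)
  have P_eq: "prob (?P d) = 1 / ?N ^ n" if "d \<in> ?V" for d
  proof -
    have "prob {\<omega> \<in> space M. (\<forall>k\<in>{..n}. D k \<omega> = d k) \<and> True} = prob {\<omega> \<in> space M. True} / ?N ^ n"
      by (rule prob_path_and_waiting_event[OF that], simp, metis sets.top)
    then show ?thesis by (simp add: prob_space)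
  qed
  have PQ_eq: "prob (?PQ d) = prob (?Q d) / ?N ^ n" if "d \<in> ?V" for d
    by (rule prob_path_and_waiting_event[OF that],
        rule near_cube_measurable[where w = "\<lambda>\<omega> k. W k \<omega>" and d = "\<lambda>_. d"]) auto
  have D_eq: "{\<omega> \<in> space M. D k \<omega> = v} \<in> events" for k v
  proof (cases "v \<in> directions")
    case True
    then show ?thesis
      using measurable_sets[OF direction_measurable[of k], of "{v}"]
      by (simp add: vimage_def Int_def conj_commute)
  next
    case False
    then have "{\<omega> \<in> space M. D k \<omega> = v} = {}"
      using measurable_space[OF direction_measurable[of k]] by auto
    then show ?thesis by (metis sets.empty_sets)
  qed
  then have P_event: "?P d \<in> events" for d by (intro sets.sets_Collect_finite_All) auto
  have PQ_event: "?PQ d \<in> events" for d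
  proof -
    have "?PQ d = ?P d \<inter> ?Q d" by auto
    then show ?thesis using P_event by simp
  qed
  have Union_events: "(\<Union>d\<in>?V. ?P d) \<in> events" "(\<Union>d\<in>?V. ?PQ d) \<in> events"
    using finV P_event PQ_event by (blast intro: sets.finite_UN)+
  have disj: "disjoint_family_on ?P ?V"
  proof (unfold disjoint_family_on_def, intro ballI impI)
    fix d d' assume dd: "d \<in> ?V" "d' \<in> ?V" "d \<noteq> d'"
    then obtain k where "d k \<noteq> d' k" by auto
    moreover from this have "k \<le> n"
      using direction_pathsD(4)[OF dd(1), of k] direction_pathsD(4)[OF dd(2), of k] by force
    ultimately show "?P d \<inter> ?P d' = {}" by auto
  qed
  \<comment> \<open>The paths in \<open>?V\<close> already have total probability 1. In particular repeated directions
      and initial directions other than \<open>e0\<close> have probability 0.\<close>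
  have "prob (\<Union>d\<in>?V. ?P d) = (\<Sum>d\<in>?V. prob (?P d))"
    using finV disj P_event by (intro finite_measure_finite_Union) auto
  also have "\<dots> = 1" using P_eq cardV N by simp
  finally have "prob (space M - (\<Union>d\<in>?V. ?P d)) = 0"
    using Union_events by (subst prob_compl) auto
  moreover have "?E \<subseteq> (\<Union>d\<in>?V. ?PQ d) \<union> (space M - (\<Union>d\<in>?V. ?P d))"
  proof
    fix \<omega> assume \<omega>: "\<omega> \<in> ?E"
    show "\<omega> \<in> (\<Union>d\<in>?V. ?PQ d) \<union> (space M - (\<Union>d\<in>?V. ?P d))"
    proof (cases "\<omega> \<in> (\<Union>d\<in>?V. ?P d)")
      case True
      then obtain d where d: "d \<in> ?V" "\<forall>k\<in>{..n}. D k \<omega> = d k" by auto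
      then have "near_cube (\<lambda>k. W k \<omega>) R n d"
        using \<omega> by (simp add: near_cube_def position_def)
      then show ?thesis using d \<omega> by auto
    qed (use \<omega> in auto)
  qed
  then have "prob ?E \<le> prob ((\<Union>d\<in>?V. ?PQ d) \<union> (space M - (\<Union>d\<in>?V. ?P d)))"
    using Union_events by (intro finite_measure_mono) auto
  moreover have "prob ((\<Union>d\<in>?V. ?PQ d) \<union> (space M - (\<Union>d\<in>?V. ?P d)))
      \<le> prob (\<Union>d\<in>?V. ?PQ d) + prob (space M - (\<Union>d\<in>?V. ?P d))"
    using Union_events by (intro measure_Un_le) auto
  moreover have "prob (\<Union>d\<in>?V. ?PQ d) \<le> (\<Sum>d\<in>?V. prob (?PQ d))"
    using finV PQ_event by (intro measure_UNION_le) auto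
  ultimately have "prob ?E \<le> (\<Sum>d\<in>?V. prob (?PQ d))" by linarith
  also have "\<dots> = (\<Sum>d\<in>?V. expectation (indicator (?Q d))) / ?N ^ n"
    using PQ_eq by (simp add: sum_divide_distrib)
  also have "(\<Sum>d\<in>?V. expectation (indicator (?Q d)))
      = expectation (\<lambda>\<omega>. \<Sum>d\<in>?V. indicator (?Q d) \<omega> :: real)"
    by (rule Bochner_Integration.integral_sum[symmetric]) (simp add: integrable_indicator_iff emeasure_eq_measure)
  also have "\<dots> = expectation (\<lambda>\<omega>. real (card {d \<in> ?V. near_cube (\<lambda>k. W k \<omega>) R n d}))"
    using finV by (intro Bochner_Integration.integral_cong)
      (auto simp: indicator_def sum.If_cases Int_def)
  also have "\<dots> / ?N ^ n = expectation (\<lambda>\<omega>. real (card {d \<in> ?V. near_cube (\<lambda>k. W k \<omega>) R n d}) / real (card ?V))"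
    using cardV by simp
  finally show ?thesis .
qed

lemma expectation_prod_waiting_times:
  fixes g :: "real \<Rightarrow> real"
  assumes "g \<in> borel_measurable borel" "\<And>x. \<bar>g x\<bar> \<le> 1" "inj f"
  shows "expectation (\<lambda>\<omega>. \<Prod>k<K. g (W (f k) \<omega>)) = (expectation (\<lambda>\<omega>. g (W 0 \<omega>))) ^ K"
proof -
  have W [measurable]: "W k \<in> borel_measurable M" for k by (rule waiting_time_measurable)
  note [measurable] = assms(1)
  have "indep_vars (\<lambda>_. borel) (\<lambda>k \<omega>. g (W k \<omega>)) UNIV"
    by (rule indep_vars_compose2[OF indep_waiting_times]) (rule assms(1))
  then have "indep_vars (\<lambda>_. borel) (\<lambda>k \<omega>. g (W k \<omega>)) (f ` {..<K})"
    by (rule indep_vars_subset) simp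
  then have "expectation (\<lambda>\<omega>. \<Prod>j\<in>f ` {..<K}. g (W j \<omega>))
      = (\<Prod>j\<in>f ` {..<K}. expectation (\<lambda>\<omega>. g (W j \<omega>)))"
    by (rule indep_vars_lebesgue_integral[rotated])
       (auto intro!: integrable_const_bound[where B = 1] simp: assms(2))
  also have "\<dots> = (\<Prod>j\<in>f ` {..<K}. expectation (\<lambda>\<omega>. g (W 0 \<omega>)))"
  proof (rule prod.cong[OF refl])
    fix j
    have "integral\<^sup>L (distr M borel (W j)) g = integral\<^sup>L (distr M borel (W 0)) g"
      by (simp only: waiting_time_distr)
    then show "expectation (\<lambda>\<omega>. g (W j \<omega>)) = expectation (\<lambda>\<omega>. g (W 0 \<omega>))"
      by (simp add: integral_distr)
  qed
  also have "\<dots> = expectation (\<lambda>\<omega>. g (W 0 \<omega>)) ^ K"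
    using assms(3) by (simp add: card_image inj_on_subset)
  finally show ?thesis
    using assms(3) by (simp add: prod.reindex inj_on_subset)
qed

end

section \<open>Tails and quantiles\<close>

lemma (in real_distribution) tendsto_upper_tail_abs:
  "(\<lambda>k. prob {x. t + inverse (real (Suc k)) \<le> \<bar>x\<bar>}) \<longlonglongrightarrow> prob {x. t < \<bar>x\<bar>}"
proof -
  have "incseq (\<lambda>k. {x :: real. t + inverse (real (Suc k)) \<le> \<bar>x\<bar>})"
  proof (rule incseq_SucI, clarify)
    fix k and x :: real assume "t + inverse (real (Suc k)) \<le> \<bar>x\<bar>"
    moreover have "inverse (real (Suc (Suc k))) \<le> inverse (real (Suc k))"
      by (intro le_imp_inverse_le) auto
    ultimately show "t + inverse (real (Suc (Suc k))) \<le> \<bar>x\<bar>" by linarith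
  qed
  then have "(\<lambda>k. prob {x. t + inverse (real (Suc k)) \<le> \<bar>x\<bar>})
      \<longlonglongrightarrow> prob (\<Union>k. {x. t + inverse (real (Suc k)) \<le> \<bar>x\<bar>})"
    by (intro finite_Lim_measure_incseq) auto
  also have "(\<Union>k. {x. t + inverse (real (Suc k)) \<le> \<bar>x\<bar>}) = {x. t < \<bar>x\<bar>}"
  proof (intro set_eqI iffI)
    fix x assume "x \<in> {x. t < \<bar>x\<bar>}"
    then have "0 < \<bar>x\<bar> - t" by simp
    from reals_Archimedean[OF this] obtain k where "inverse (real (Suc k)) < \<bar>x\<bar> - t" ..
    then show "x \<in> (\<Union>k. {x. t + inverse (real (Suc k)) \<le> \<bar>x\<bar>})" by (auto intro!: exI[of _ k])
  next
    fix x assume "x \<in> (\<Union>k. {x. t + inverse (real (Suc k)) \<le> \<bar>x\<bar>})"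
    then obtain k where "t + inverse (real (Suc k)) \<le> \<bar>x\<bar>" by auto
    moreover have "0 < inverse (real (Suc k))" by simp
    ultimately show "x \<in> {x. t < \<bar>x\<bar>}" by (simp del: of_nat_Suc inverse_positive_iff_positive)
  qed
  finally show ?thesis .
qed

lemma (in real_distribution) upper_quantile_abs:
  assumes "0 < u" "u \<le> prob {x. \<delta> \<le> \<bar>x\<bar>}"
  obtains t where "\<delta> \<le> t" "u \<le> prob {x. t \<le> \<bar>x\<bar>}" "prob {x. t < \<bar>x\<bar>} \<le> u"
proof -
  define G where "G s = prob {x. s \<le> \<bar>x\<bar>}" for s
  have G_antimono: "G s' \<le> G s" if "s \<le> s'" for s s'
    unfolding G_def using that by (intro finite_measure_mono) auto
  define S where "S = {s. u \<le> G s}"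
  have \<delta>S: "\<delta> \<in> S" using assms by (simp add: S_def G_def)
  have "(\<lambda>k. G (real k)) \<longlonglongrightarrow> prob (\<Inter>k. {x. real k \<le> \<bar>x\<bar>})"
    unfolding G_def by (intro finite_Lim_measure_decseq) (auto simp: decseq_def)
  moreover have "(\<Inter>k. {x. real k \<le> \<bar>x\<bar>}) = {}"
  proof -
    have "\<exists>k. \<not> real k \<le> \<bar>x\<bar>" for x using reals_Archimedean2[of "\<bar>x\<bar>"] by (auto simp: not_le)
    then show ?thesis by auto
  qed
  ultimately have "(\<lambda>k. G (real k)) \<longlonglongrightarrow> 0" by simp
  then have "eventually (\<lambda>k. G (real k) < u) sequentially"
    using assms(1) by (rule order_tendstoD)
  then obtain k where k: "G (real k) < u" by (auto simp: eventually_sequentially)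
  have bdd: "bdd_above S"
  proof (rule bdd_aboveI)
    fix s assume "s \<in> S"
    then show "s \<le> real k" using k G_antimono[of "real k" s] by (force simp: S_def)
  qed
  define t where "t = Sup S"
  have "\<delta> \<le> t" unfolding t_def by (rule cSup_upper[OF \<delta>S bdd])
  moreover have "u \<le> G t"
  proof -
    have dec: "decseq (\<lambda>k. {x :: real. t - inverse (real (Suc k)) \<le> \<bar>x\<bar>})"
    proof (rule decseq_SucI, clarify)
      fix k and x :: real assume "t - inverse (real (Suc (Suc k))) \<le> \<bar>x\<bar>"
      moreover have "inverse (real (Suc (Suc k))) \<le> inverse (real (Suc k))"
        by (intro le_imp_inverse_le) auto
      ultimately show "t - inverse (real (Suc k)) \<le> \<bar>x\<bar>" by linarith
    qed
    have "(\<lambda>k. G (t - inverse (real (Suc k))))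
        \<longlonglongrightarrow> prob (\<Inter>k. {x. t - inverse (real (Suc k)) \<le> \<bar>x\<bar>})"
      unfolding G_def by (intro finite_Lim_measure_decseq dec) auto
    moreover have "(\<Inter>k. {x. t - inverse (real (Suc k)) \<le> \<bar>x\<bar>}) = {x. t \<le> \<bar>x\<bar>}"
    proof (intro set_eqI iffI)
      fix x assume x: "x \<in> (\<Inter>k. {x. t - inverse (real (Suc k)) \<le> \<bar>x\<bar>})"
      show "x \<in> {x. t \<le> \<bar>x\<bar>}"
      proof (rule ccontr)
        assume "x \<notin> {x. t \<le> \<bar>x\<bar>}"
        then have "0 < t - \<bar>x\<bar>" by simp
        from reals_Archimedean[OF this] obtain k where "inverse (real (Suc k)) < t - \<bar>x\<bar>" ..
        moreover have "t - inverse (real (Suc k)) \<le> \<bar>x\<bar>" using x by blast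
        ultimately show False by linarith
      qed
    next
      fix x assume "x \<in> {x. t \<le> \<bar>x\<bar>}"
      moreover have "0 < inverse (real (Suc k))" for k by simp
      ultimately show "x \<in> (\<Inter>k. {x. t - inverse (real (Suc k)) \<le> \<bar>x\<bar>})"
        by (auto simp del: of_nat_Suc intro: order_trans[rotated])
    qed
    ultimately have "(\<lambda>k. G (t - inverse (real (Suc k)))) \<longlonglongrightarrow> G t" by (simp add: G_def)
    moreover have "u \<le> G (t - inverse (real (Suc k)))" for k
    proof -
      have "t - inverse (real (Suc k)) < t" by simp
      then obtain s where "s \<in> S" "t - inverse (real (Suc k)) < s"
        unfolding t_def using less_cSup_iff[OF _ bdd] \<delta>S by blast
      then show ?thesis using G_antimono[of "t - inverse (real (Suc k))" s] by (simp add: S_def)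
    qed
    ultimately show ?thesis by (intro LIMSEQ_le_const) auto
  qed
  moreover have "prob {x. t < \<bar>x\<bar>} \<le> u"
  proof (rule LIMSEQ_le_const2[OF tendsto_upper_tail_abs], intro exI allI impI)
    fix k :: nat
    have "t < t + inverse (real (Suc k))" by simp
    then have "t + inverse (real (Suc k)) \<notin> S"
      unfolding t_def using cSup_upper[OF _ bdd] by (meson not_le)
    then show "prob {x. t + inverse (real (Suc k)) \<le> \<bar>x\<bar>} \<le> u"
      by (simp add: S_def G_def)
  qed
  ultimately show ?thesis using that by (simp add: G_def)
qed

section \<open>Decay of the hitting probabilities\<close>

lemma ex_two_other_axes:
  fixes i :: "'n :: finite"
  assumes "3 \<le> CARD('n)"
  obtains b c :: 'n where "i \<noteq> b" "i \<noteq> c" "b \<noteq> c"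
proof -
  have "card (UNIV - {i}) \<ge> 2" using assms by (simp add: card_Diff_singleton)
  then obtain T where "T \<subseteq> UNIV - {i}" "card T = 2" by (meson obtain_subset_with_card_n)
  then obtain b c where "T = {b, c}" "b \<noteq> c" "i \<notin> T" by (auto simp: card_2_iff)
  then show ?thesis using that[of b c] by auto
qed

text \<open>
  The bound of \<open>card_near_cube_paths\<close> is summed over the axis \<open>i\<close> of the last step, with threshold \<open>t\<close> on this
  axis and \<open>\<delta>\<close> on all others. The numbers \<open>m\<close> and \<open>m'\<close> are the required numbers of isolated steps.
\<close>

lemma card_near_cube_paths_le:
  fixes e0 :: "real ^ 'n" and w :: "nat \<Rightarrow> real"
  assumes e0: "e0 \<in> directions" and three: "3 \<le> CARD('n)" and K: "3 * K \<le> n"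
    and \<delta>: "0 < \<delta>" "\<delta> \<le> t" and R: "0 \<le> R" and m: "0 < m" "0 < m'"
  defines "C \<equiv> R / \<delta> + 2" and "\<kappa> \<equiv> 1 / (2 * (2 * real CARD('n) - 1) ^ 3)"
  shows "real (card {d \<in> direction_paths e0 n. near_cube w R n d}) / real (card (direction_paths e0 n))
    \<le> real CARD('n) * (2 * exp m * (\<Prod>k<K. if \<delta> \<le> \<bar>w (3 * k + 2)\<bar> then 1 - \<kappa> else 1)
        + exp m' * (\<Prod>k<K. if t \<le> \<bar>w (3 * k + 2)\<bar> then 1 - \<kappa> else 1)
        + C\<^sup>2 / m * ((if t < \<bar>w n\<bar> then 1 else 0) + C / sqrt m'))" (is "_ \<le> _ * ?F")
proof -
  let ?V = "direction_paths e0 n"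
  have finV: "finite ?V" by (rule finite_direction_paths[OF e0])
  have two: "2 \<le> CARD('n)" using three by simp
  have V_pos: "0 < real (card ?V)" unfolding card_direction_paths[OF e0] using two by simp
  have axis: "real (card {d \<in> ?V. d n $ i \<noteq> 0 \<and> near_cube w R n d}) \<le> ?F * real (card ?V)" for i :: 'n
  proof -
    obtain b c :: 'n where ibc: "i \<noteq> b" "i \<noteq> c" "b \<noteq> c" using ex_two_other_axes[OF three] .
    define \<tau> where "\<tau> = (\<lambda>a. if a = i then t else \<delta>)"
    note few = card_few_isolated_steps[OF e0 two K, of w \<tau>, folded \<kappa>_def]
    have \<tau>_eq: "\<tau> i = t" "\<tau> b = \<delta>" "\<tau> c = \<delta>" using ibc by (auto simp: \<tau>_def)
    show ?thesis
      using card_near_cube_paths[OF e0 K \<delta> \<tau>_def R ibc m, of w] few[of b m] few[of c m] few[of i m']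
      unfolding \<tau>_eq C_def[symmetric] by (simp add: algebra_simps)
  qed
  have "{d \<in> ?V. near_cube w R n d} \<subseteq> (\<Union>i. {d \<in> ?V. d n $ i \<noteq> 0 \<and> near_cube w R n d})"
    using direction_nonzero_nth[OF direction_pathsD(2)] by fastforce
  then have "card {d \<in> ?V. near_cube w R n d} \<le> card (\<Union>i. {d \<in> ?V. d n $ i \<noteq> 0 \<and> near_cube w R n d})"
    using finV by (intro card_mono) auto
  also have "\<dots> \<le> (\<Sum>i\<in>UNIV. card {d \<in> ?V. d n $ i \<noteq> 0 \<and> near_cube w R n d})"
    by (rule card_UN_le) simp
  finally have "real (card {d \<in> ?V. near_cube w R n d})
      \<le> (\<Sum>i\<in>UNIV. real (card {d \<in> ?V. d n $ i \<noteq> 0 \<and> near_cube w R n d}))"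
    by (simp only: of_nat_le_iff of_nat_sum[symmetric])
  also have "\<dots> \<le> (\<Sum>i\<in>(UNIV :: 'n set). ?F * real (card ?V))" by (intro sum_mono axis)
  finally have "real (card {d \<in> ?V. near_cube w R n d}) \<le> real CARD('n) * ?F * real (card ?V)" by simp
  then show ?thesis using V_pos by (simp add: pos_divide_le_eq)
qed

context directionally_reinforced_walk
begin

lemma real_distribution_\<mu>: "real_distribution \<mu>"
  using real_distribution_distr[OF waiting_time_measurable[of 0]] by (simp add: waiting_time_distr)

lemma prob_waiting_time: "Measurable.pred borel P \<Longrightarrow> prob {\<omega> \<in> space M. P (W n \<omega>)} = measure \<mu> {x. P x}"
  unfolding waiting_time_distr[of n, symmetric]
  by (subst measure_distr) (auto simp: waiting_time_measurable pred_def intro!: arg_cong[where f = prob])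

lemma expectation_prod_large_waiting_times:
  assumes \<kappa>: "0 \<le> \<kappa>" "\<kappa> \<le> 1" and p: "p \<le> measure \<mu> {x. s \<le> \<bar>x\<bar>}"
  shows "expectation (\<lambda>\<omega>. \<Prod>k<K. if s \<le> \<bar>W (3 * k + 2) \<omega>\<bar> then 1 - \<kappa> else 1) \<le> exp (- (p * \<kappa> * real K))"
proof -
  have W [measurable]: "W k \<in> borel_measurable M" for k by (rule waiting_time_measurable)
  let ?A = "{\<omega> \<in> space M. s \<le> \<bar>W 0 \<omega>\<bar>}"
  have "expectation (\<lambda>\<omega>. \<Prod>k<K. if s \<le> \<bar>W (3 * k + 2) \<omega>\<bar> then 1 - \<kappa> else 1)
     = expectation (\<lambda>\<omega>. if s \<le> \<bar>W 0 \<omega>\<bar> then 1 - \<kappa> else 1) ^ K"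
    using \<kappa> by (intro expectation_prod_waiting_times[where g = "\<lambda>x. if s \<le> \<bar>x\<bar> then 1 - \<kappa> else 1"])
      (auto simp: inj_on_def)
  also have "expectation (\<lambda>\<omega>. if s \<le> \<bar>W 0 \<omega>\<bar> then 1 - \<kappa> else 1)
      = expectation (\<lambda>\<omega>. 1 - \<kappa> * indicator ?A \<omega>)"
    by (intro Bochner_Integration.integral_cong) (auto simp: indicator_def)
  also have "\<dots> = 1 - \<kappa> * prob ?A"
  proof -
    have "integrable M (indicator ?A :: 'a \<Rightarrow> real)"
      by (simp add: integrable_indicator_iff emeasure_eq_measure)
    then show ?thesis by (subst Bochner_Integration.integral_diff) (auto simp: prob_space)
  qed
  also have "prob ?A = measure \<mu> {x. s \<le> \<bar>x\<bar>}" by (rule prob_waiting_time) measurable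
  also have "(1 - \<kappa> * measure \<mu> {x. s \<le> \<bar>x\<bar>}) ^ K \<le> exp (- (p * \<kappa>)) ^ K"
  proof (rule power_mono)
    have "1 - \<kappa> * measure \<mu> {x. s \<le> \<bar>x\<bar>} \<le> 1 - p * \<kappa>"
      using mult_right_mono[OF p \<kappa>(1)] by (simp add: mult.commute)
    also have "\<dots> \<le> exp (- (p * \<kappa>))" using exp_ge_add_one_self[of "- (p * \<kappa>)"] by simp
    finally show "1 - \<kappa> * measure \<mu> {x. s \<le> \<bar>x\<bar>} \<le> exp (- (p * \<kappa>))" .
    have "measure \<mu> {x. s \<le> \<bar>x\<bar>} \<le> 1"
      using real_distribution_\<mu> by (simp add: real_distribution_def prob_space.prob_le_1)
    then show "0 \<le> 1 - \<kappa> * measure \<mu> {x. s \<le> \<bar>x\<bar>}" using \<kappa> by (simp add: mult_le_one)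
  qed
  also have "exp (- (p * \<kappa>)) ^ K = exp (- (p * \<kappa> * real K))"
    by (simp add: exp_of_nat_mult[symmetric] mult_ac)
  finally show ?thesis .
qed

lemma prob_near_cube_bound:
  assumes e0: "e0 \<in> directions" and three: "3 \<le> CARD('n)" and K: "3 * K \<le> n"
    and \<delta>: "0 < \<delta>" "\<delta> \<le> t" and R: "0 \<le> R" and m: "0 < m" "0 < m'"
    and p: "p \<le> measure \<mu> {x. \<delta> \<le> \<bar>x\<bar>}"
    and u: "u \<le> measure \<mu> {x. t \<le> \<bar>x\<bar>}" "measure \<mu> {x. t < \<bar>x\<bar>} \<le> u"
  defines "C \<equiv> R / \<delta> + 2" and "\<kappa> \<equiv> 1 / (2 * (2 * real CARD('n) - 1) ^ 3)"
  shows "prob {\<omega> \<in> space M. near_cube (\<lambda>k. W k \<omega>) R n (\<lambda>k. D k \<omega>)}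
    \<le> real CARD('n) * (2 * exp (m - p * \<kappa> * real K) + exp (m' - u * \<kappa> * real K)
        + C\<^sup>2 / m * (u + C / sqrt m'))"
proof -
  let ?V = "direction_paths e0 n" and ?m = "real CARD('n)"
  let ?\<Pi> = "\<lambda>s \<omega>. \<Prod>k<K. if s \<le> \<bar>W (3 * k + 2) \<omega>\<bar> then 1 - \<kappa> else 1"
  let ?B = "{\<omega> \<in> space M. t < \<bar>W n \<omega>\<bar>}"
  let ?F = "\<lambda>\<omega>. ?m * (2 * exp m * ?\<Pi> \<delta> \<omega> + exp m' * ?\<Pi> t \<omega> + C\<^sup>2 / m * (indicator ?B \<omega> + C / sqrt m'))"
  have W [measurable]: "W k \<in> borel_measurable M" for k by (rule waiting_time_measurable)
  have "1 \<le> (2 * ?m - 1) ^ 3" using three by (intro one_le_power) simp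
  moreover have "0 \<le> 1 / (2 * x) \<and> 1 / (2 * x) \<le> 1" if "1 \<le> x" for x :: real
    using that by (simp add: divide_le_eq)
  ultimately have \<kappa>: "0 \<le> \<kappa>" "\<kappa> \<le> 1" unfolding \<kappa>_def by blast+
  have int_\<Pi>: "integrable M (?\<Pi> s)" for s
  proof (rule integrable_const_bound[where B = 1])
    have "0 \<le> ?\<Pi> s \<omega> \<and> ?\<Pi> s \<omega> \<le> 1" for \<omega>
      using \<kappa> by (intro conjI prod_nonneg prod_le_1) auto
    then show "AE \<omega> in M. norm (?\<Pi> s \<omega>) \<le> 1" by simp
  qed measurable
  have int_B: "integrable M (indicator ?B :: 'a \<Rightarrow> real)" by (simp add: integrable_indicator_iff emeasure_eq_measure)
  have finV: "finite ?V" by (rule finite_direction_paths[OF e0])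
  have "prob {\<omega> \<in> space M. near_cube (\<lambda>k. W k \<omega>) R n (\<lambda>k. D k \<omega>)}
    \<le> expectation (\<lambda>\<omega>. real (card {d \<in> ?V. near_cube (\<lambda>k. W k \<omega>) R n d}) / real (card ?V))"
    by (rule prob_near_cube_le[OF e0])
  also have "\<dots> \<le> expectation ?F"
  proof (rule integral_mono')
    show "integrable M ?F"
      by (intro integrable_mult_right Bochner_Integration.integrable_add int_\<Pi> int_B integrable_const)
    have le: "real (card {d \<in> ?V. near_cube (\<lambda>k. W k \<omega>) R n d}) / real (card ?V) \<le> ?F \<omega>"
      if "\<omega> \<in> space M" for \<omega>
    proof -
      have ind: "indicator ?B \<omega> = (if t < \<bar>W n \<omega>\<bar> then 1 else 0 :: real)"
        using that by (simp add: indicator_def)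
      show ?thesis
        unfolding ind C_def \<kappa>_def by (rule card_near_cube_paths_le[OF e0 three K \<delta> R m])
    qed
    then show "\<And>\<omega>. \<omega> \<in> space M \<Longrightarrow>
      real (card {d \<in> ?V. near_cube (\<lambda>k. W k \<omega>) R n d}) / real (card ?V) \<le> ?F \<omega>" .
    show "0 \<le> ?F \<omega>" if "\<omega> \<in> space M" for \<omega>
      by (rule order_trans[OF _ le[OF that]]) simp
  qed
  also have "\<dots> = ?m * (2 * exp m * expectation (?\<Pi> \<delta>) + exp m' * expectation (?\<Pi> t)
      + C\<^sup>2 / m * (prob ?B + C / sqrt m'))"
    using int_\<Pi> int_B by (simp add: prob_space)
  also have "\<dots> \<le> ?m * (2 * exp m * exp (- (p * \<kappa> * real K)) + exp m' * exp (- (u * \<kappa> * real K))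
      + C\<^sup>2 / m * (u + C / sqrt m'))"
  proof -
    have "prob ?B = measure \<mu> {x. t < \<bar>x\<bar>}" by (rule prob_waiting_time) measurable
    then have "prob ?B \<le> u" using u(2) by simp
    then show ?thesis
      using expectation_prod_large_waiting_times[OF \<kappa> p, of K]
        expectation_prod_large_waiting_times[OF \<kappa> u(1), of K] m
      by (intro mult_left_mono add_mono) auto
  qed
  finally show ?thesis by (simp add: exp_diff exp_minus field_simps)
qed

lemma prob_near_cube_decay:
  assumes e0: "e0 \<in> directions" and three: "3 \<le> CARD('n)"
    and \<delta>: "0 < \<delta>" "0 < measure \<mu> {x. \<delta> \<le> \<bar>x\<bar>}" and R: "0 \<le> R"
  obtains c where "\<And>n. 3 \<le> n \<Longrightarrow>
    prob {\<omega> \<in> space M. near_cube (\<lambda>k. W k \<omega>) R n (\<lambda>k. D k \<omega>)} \<le> c * real (n div 3) powr (- 5 / 4)"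
proof -
  interpret \<mu>: real_distribution \<mu> by (rule real_distribution_\<mu>)
  let ?m = "real CARD('n)"
  define C where "C = R / \<delta> + 2"
  define \<kappa> where "\<kappa> = 1 / (2 * (2 * ?m - 1) ^ 3)"
  define p where "p = measure \<mu> {x. \<delta> \<le> \<bar>x\<bar>}"
  define a where "a = p * \<kappa> / 2"
  define c where "c = ?m * (3 * (2 / a\<^sup>2) + C\<^sup>2 / a * (p + C / sqrt a))"
  have \<kappa>: "0 < \<kappa>" using three by (simp add: \<kappa>_def)
  have p: "0 < p" using \<delta>(2) by (simp add: p_def)
  have a: "0 < a" using \<kappa> p by (simp add: a_def)
  have C: "0 < C" using R \<delta> by (simp add: C_def add_nonneg_pos)
  have "prob {\<omega> \<in> space M. near_cube (\<lambda>k. W k \<omega>) R n (\<lambda>k. D k \<omega>)} \<le> c * real (n div 3) powr (- 5 / 4)"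
    if n: "3 \<le> n" for n
  proof -
    define K where "K = n div 3"
    have K: "3 * K \<le> n" "1 \<le> K" using n by (auto simp: K_def)
    \<comment> \<open>In terms of \<open>s\<close> the quantile level is \<open>u = p / s\<close>. The expected numbers of isolated steps
        are at least of order \<open>p * \<kappa> * s ^ 4\<close> and \<open>u * \<kappa> * s ^ 4 = p * \<kappa> * s ^ 3\<close>; half of these values is
        required below, namely \<open>a * s ^ 4\<close> and \<open>a * s ^ 3\<close>.\<close>
    define s where "s = real K powr (1 / 4)"
    have s1: "1 \<le> s" using K by (simp add: s_def ge_one_powr_ge_zero)
    have s4: "s ^ 4 = real K" and s5: "s ^ 5 = real K powr (5 / 4)"
      using K by (auto simp: s_def powr_power)
    define u where "u = p / s"
    have u: "0 < u" "u \<le> p" using p s1 by (auto simp: u_def divide_le_eq)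
    obtain t where t: "\<delta> \<le> t" "u \<le> measure \<mu> {x. t \<le> \<bar>x\<bar>}" "measure \<mu> {x. t < \<bar>x\<bar>} \<le> u"
      using \<mu>.upper_quantile_abs[OF u(1), of \<delta>] u(2) by (auto simp: p_def)
    have s35: "s ^ 3 \<le> s ^ 4" "s ^ 5 \<le> (s ^ 3)\<^sup>2" "s\<^sup>2 \<le> s ^ 3"
      using s1 by (auto intro!: power_increasing simp: power_mult[symmetric])
    have exp_le: "exp (- (a * y)) \<le> 2 / a\<^sup>2 / s ^ 5" if "s ^ 3 \<le> y" for y
    proof -
      have "a * s ^ 3 \<le> a * y" using that a by simp
      then have "exp (- (a * y)) \<le> exp (- (a * s ^ 3))" by simp
      also have "\<dots> \<le> 2 / (a * s ^ 3)\<^sup>2"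
      proof -
        have pos: "0 < a * s ^ 3" using a s1 by simp
        then have "(a * s ^ 3)\<^sup>2 / 2 \<le> exp (a * s ^ 3)"
          using exp_lower_Taylor_quadratic[of "a * s ^ 3"] by linarith
        then have "1 / exp (a * s ^ 3) \<le> 1 / ((a * s ^ 3)\<^sup>2 / 2)"
          using pos a s1 by (intro divide_left_mono mult_pos_pos divide_pos_pos zero_less_power) auto
        then show ?thesis by (simp add: exp_minus inverse_eq_divide)
      qed
      also have "\<dots> = 2 / a\<^sup>2 / (s ^ 3)\<^sup>2" by (simp add: power_mult_distrib)
      also have "\<dots> \<le> 2 / a\<^sup>2 / s ^ 5"
        using s35 s1 by (intro divide_left_mono) auto
      finally show ?thesis .
    qed
    have "prob {\<omega> \<in> space M. near_cube (\<lambda>k. W k \<omega>) R n (\<lambda>k. D k \<omega>)}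
      \<le> ?m * (2 * exp (a * s ^ 4 - p * \<kappa> * real K) + exp (a * s ^ 3 - u * \<kappa> * real K)
        + C\<^sup>2 / (a * s ^ 4) * (u + C / sqrt (a * s ^ 3)))"
      unfolding C_def \<kappa>_def
      by (rule prob_near_cube_bound[OF e0 three K(1) \<delta>(1) t(1) R _ _ _ t(2,3)])
         (use a s1 in \<open>auto simp: p_def\<close>)
    also have "a * s ^ 4 - p * \<kappa> * real K = - (a * s ^ 4)" by (simp add: a_def s4)
    also have "a * s ^ 3 - u * \<kappa> * real K = - (a * s ^ 3)"
      using s1 by (simp add: a_def u_def s4[symmetric] field_simps eval_nat_numeral)
    also have "?m * (2 * exp (- (a * s ^ 4)) + exp (- (a * s ^ 3)) + C\<^sup>2 / (a * s ^ 4) * (u + C / sqrt (a * s ^ 3)))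
      \<le> ?m * (2 * (2 / a\<^sup>2 / s ^ 5) + 2 / a\<^sup>2 / s ^ 5 + C\<^sup>2 / (a * s ^ 4) * (p / s + C / sqrt a / s))"
    proof -
      have "sqrt a * s = sqrt (a * s\<^sup>2)" using s1 by (simp add: real_sqrt_mult)
      also have "\<dots> \<le> sqrt (a * s ^ 3)" using a s35 by simp
      finally have "C / sqrt (a * s ^ 3) \<le> C / (sqrt a * s)"
        using C a s1 by (intro divide_left_mono) auto
      then show ?thesis
        using exp_le[OF s35(1)] exp_le[of "s ^ 3"] a s1
        by (intro mult_left_mono add_mono) (auto simp: u_def)
    qed
    also have "\<dots> = c / s ^ 5"
      using a s1 by (simp add: c_def field_simps eval_nat_numeral)
    also have "\<dots> = c * real (n div 3) powr (- 5 / 4)"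
      using powr_minus_divide[of "real K" "5 / 4"] by (simp add: s5 K_def)
    finally show ?thesis .
  qed
  then show ?thesis using that by blast
qed

lemma summable_prob_near_cube:
  assumes "e0 \<in> directions" "3 \<le> CARD('n)" "0 < \<delta>" "0 < measure \<mu> {x. \<delta> \<le> \<bar>x\<bar>}" "0 \<le> R"
  shows "summable (\<lambda>n. prob {\<omega> \<in> space M. near_cube (\<lambda>k. W k \<omega>) R n (\<lambda>k. D k \<omega>)})"
proof -
  obtain c where c: "\<And>n. 3 \<le> n \<Longrightarrow> prob {\<omega> \<in> space M. near_cube (\<lambda>k. W k \<omega>) R n (\<lambda>k. D k \<omega>)}
      \<le> c * real (n div 3) powr (- 5 / 4)"
    using prob_near_cube_decay[OF assms] by blast
  have "summable (\<lambda>n. \<bar>c\<bar> * 5 powr (5 / 4) * real n powr (- 5 / 4))"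
    by (intro summable_mult) (simp add: summable_real_powr_iff)
  then show ?thesis
  proof (rule summable_comparison_test'[where N = 3])
    fix n :: nat assume n: "3 \<le> n"
    have "n \<le> 5 * (n div 3)" using n by presburger
    then have "real n / 5 \<le> real (n div 3)" by linarith
    then have "real (n div 3) powr (- 5 / 4) \<le> (real n / 5) powr (- 5 / 4)"
      using n by (intro powr_mono2') auto
    also have "\<dots> = 5 powr (5 / 4) * real n powr (- 5 / 4)"
      by (simp add: powr_divide powr_minus field_simps)
    finally have "\<bar>c\<bar> * real (n div 3) powr (- 5 / 4) \<le> \<bar>c\<bar> * (5 powr (5 / 4) * real n powr (- 5 / 4))"
      by (rule mult_left_mono) simp
    moreover have "c * real (n div 3) powr (- 5 / 4) \<le> \<bar>c\<bar> * real (n div 3) powr (- 5 / 4)"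
      by (rule mult_right_mono) auto
    ultimately show "norm (prob {\<omega> \<in> space M. near_cube (\<lambda>k. W k \<omega>) R n (\<lambda>k. D k \<omega>)})
        \<le> \<bar>c\<bar> * 5 powr (5 / 4) * real n powr (- 5 / 4)"
      using c[OF n] by simp
  qed
qed

lemma segment_meets_imp_near_cube:
  assumes "closed_segment (turning_point D W n \<omega>) (turning_point D W (Suc n) \<omega>) \<inter> B \<noteq> {}"
    and "\<And>z. z \<in> B \<Longrightarrow> norm z \<le> R"
  shows "near_cube (\<lambda>k. W k \<omega>) R n (\<lambda>k. D k \<omega>)"
  unfolding near_cube_def
proof
  fix a
  let ?x = "position (\<lambda>k. W k \<omega>) (\<lambda>k. D k \<omega>) n"
  have tp: "turning_point D W n \<omega> = ?x" "turning_point D W (Suc n) \<omega> = ?x + W n \<omega> *\<^sub>R D n \<omega>"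
    by (simp_all add: turning_point_def position_def)
  obtain s where s: "0 \<le> s" "s \<le> 1" and z: "(1 - s) *\<^sub>R ?x + s *\<^sub>R (?x + W n \<omega> *\<^sub>R D n \<omega>) \<in> B"
    using assms(1) unfolding tp by (auto simp: in_segment)
  have "(1 - s) *\<^sub>R ?x + s *\<^sub>R (?x + W n \<omega> *\<^sub>R D n \<omega>) = ?x + (s * W n \<omega>) *\<^sub>R D n \<omega>"
    by (simp add: algebra_simps)
  then have "norm (?x + (s * W n \<omega>) *\<^sub>R D n \<omega>) \<le> R" using assms(2) z by metis
  then have "\<bar>(?x + (s * W n \<omega>) *\<^sub>R D n \<omega>) $ a\<bar> \<le> R"
    using component_le_norm_cart order_trans by blast
  then have "\<bar>?x $ a + s * (W n \<omega> * D n \<omega> $ a)\<bar> \<le> R" by (simp add: mult.assoc)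
  moreover have "\<bar>s * (W n \<omega> * D n \<omega> $ a)\<bar> \<le> \<bar>W n \<omega>\<bar> * \<bar>D n \<omega> $ a\<bar>"
    using s by (simp add: abs_mult mult_left_le_one_le)
  ultimately show "\<bar>?x $ a\<bar> \<le> R + \<bar>W n \<omega>\<bar> * \<bar>D n \<omega> $ a\<bar>" by linarith
qed

end

theorem theorem2:
  fixes N :: "'b measure" and T :: "'b \<Rightarrow> real"
    and M :: "'a measure" and e0 :: "real ^ 'n"
    and D :: "nat \<Rightarrow> 'a \<Rightarrow> real ^ 'n" and W :: "nat \<Rightarrow> 'a \<Rightarrow> real"
  assumes "CARD('n) \<ge> 3"
    and "prob_space N"
    and "T \<in> borel_measurable N"
    and "AE x in N. 0 \<le> T x"
    and "measure N {x \<in> space N. 0 < T x} > 0"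
    and "e0 \<in> directions"
    and "directionally_reinforced_walk M (distr N borel T) e0 D W"
  shows "transient_walk M D W"
proof -
  interpret directionally_reinforced_walk M "distr N borel T" e0 D W by fact
  interpret N: prob_space N by fact
  interpret \<mu>: real_distribution "distr N borel T" by (rule real_distribution_\<mu>)
  let ?\<mu> = "distr N borel T"
  obtain \<delta> where \<delta>: "0 < \<delta>" "0 < measure ?\<mu> {x. \<delta> \<le> \<bar>x\<bar>}"
  proof -
    have "0 < measure N {x \<in> space N. 0 < T x}" by fact
    also have "\<dots> \<le> measure N (T -` {x. 0 < \<bar>x\<bar>} \<inter> space N)"
      using assms(3) by (intro N.finite_measure_mono) auto
    also have "\<dots> = measure ?\<mu> {x. 0 < \<bar>x\<bar>}"
      using assms(3) by (intro measure_distr[symmetric]) auto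
    finally have "eventually (\<lambda>k. 0 < measure ?\<mu> {x. 0 + inverse (real (Suc k)) \<le> \<bar>x\<bar>}) sequentially"
      by (rule order_tendstoD[OF \<mu>.tendsto_upper_tail_abs])
    then obtain k where "0 < measure ?\<mu> {x. inverse (real (Suc k)) \<le> \<bar>x\<bar>}"
      by (auto simp: eventually_sequentially)
    then show ?thesis using that[of "inverse (real (Suc k))"] by simp
  qed
  show ?thesis
    unfolding transient_walk_def
  proof (intro allI impI)
    fix B :: "(real ^ 'n) set" assume "bounded B"
    then obtain R where R: "0 < R" "\<And>z. z \<in> B \<Longrightarrow> norm z \<le> R" by (auto simp: bounded_pos)
    let ?A = "\<lambda>n. {\<omega> \<in> space M. near_cube (\<lambda>k. W k \<omega>) R n (\<lambda>k. D k \<omega>)}"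
    have "?A n \<in> events" for n
      by (rule near_cube_measurable) (auto intro: waiting_time_measurable direction_nth_measurable)
    moreover have "summable (\<lambda>n. prob (?A n))"
      using summable_prob_near_cube[OF assms(6,1) \<delta>] R by simp
    ultimately have "AE \<omega> in M. eventually (\<lambda>n. \<omega> \<in> space M - ?A n) sequentially"
      by (intro borel_cantelli_AE1) (auto simp: emeasure_eq_measure)
    then show "AE \<omega> in M. visited_finitely_often D W B \<omega>"
    proof eventually_elim
      case (elim \<omega>)
      then obtain n0 where n0: "\<And>n. n0 \<le> n \<Longrightarrow> \<omega> \<in> space M - ?A n"
        by (auto simp: eventually_sequentially)
      have "n < n0"
        if "closed_segment (turning_point D W n \<omega>) (turning_point D W (Suc n) \<omega>) \<inter> B \<noteq> {}" for n
      proof (rule ccontr)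
        assume "\<not> n < n0"
        then have "\<omega> \<in> space M - ?A n" by (intro n0) simp
        moreover have "near_cube (\<lambda>k. W k \<omega>) R n (\<lambda>k. D k \<omega>)"
          using segment_meets_imp_near_cube[OF that R(2)] .
        ultimately show False by blast
      qed
      then have "{n. closed_segment (turning_point D W n \<omega>) (turning_point D W (Suc n) \<omega>) \<inter> B \<noteq> {}}
          \<subseteq> {..<n0}" by blast
      then show ?case
        unfolding visited_finitely_often_def by (rule finite_subset) simp
    qed
  qed
qed

end
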